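(* Let $\lambda\in\mathbb{R}$ and let $\alpha\in\mathbb{R}$ be such that $\alpha/(2\pi)$ is irrational. Let $H$ be the discrete Schrödinger operator on $\ell^2(\mathbb{Z})$ with potential $n\mapsto\lambda\cos(\alpha n)$. Let $\widetilde H$ be the discrete Schrödinger operator on $\ell^2(\{0,1,2,\dots\})$ with potential $n\mapsto\lambda\cos(\alpha n+\sqrt{n})$. Then $$\sigma_{\mathrm{ess}}(\widetilde H)=\sigma(H).$$
   Context: The discrete Schrödinger operator with real potential $v$ acts by $(Hu)(n)=u(n+1)+u(n-1)+v(n)u(n)$; on $\ell^2(\{0,1,2,\dots\})$ one uses the convention $u(-1)=0$. $\sigma$ denotes spectrum and $\sigma_{\mathrm{ess}}$ essential spectrum. *)

theory Defs
  imports "HOL-Analysis.Analysis"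
begin

section \<open>The space of square-summable complex functions\<close>

definition square_summable :: "('a \<Rightarrow> complex) \<Rightarrow> bool" where
  "square_summable f \<longleftrightarrow> (\<lambda>x. (cmod (f x))\<^sup>2) summable_on UNIV"

lemma square_summable_bound:
  assumes "square_summable f" "square_summable g"
    and "\<And>x. \<bar>h x\<bar> \<le> C * ((cmod (f x))\<^sup>2 + (cmod (g x))\<^sup>2)"
  shows "(h :: 'a \<Rightarrow> real) summable_on UNIV"
proof -
  have "(\<lambda>x. C * ((cmod (f x))\<^sup>2 + (cmod (g x))\<^sup>2)) summable_on UNIV"
    using assms(1,2) unfolding square_summable_def
    by (intro summable_on_cmult_right summable_on_add)
  hence "(\<lambda>x. norm (C * ((cmod (f x))\<^sup>2 + (cmod (g x))\<^sup>2))) summable_on UNIV"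
    by (rule summable_on_iff_abs_summable_on_real[THEN iffD1])
  hence "(\<lambda>x. norm (h x)) summable_on UNIV"
  proof (rule Infinite_Sum.abs_summable_on_comparison_test)
    fix x
    show "norm (h x) \<le> norm (C * ((cmod (f x))\<^sup>2 + (cmod (g x))\<^sup>2))"
      using assms(3)[of x] by simp
  qed
  thus ?thesis by (rule summable_on_iff_abs_summable_on_real[THEN iffD2])
qed

lemma square_summable_0: "square_summable (\<lambda>_. 0)"
  by (simp add: square_summable_def)

lemma square_summable_add:
  assumes "square_summable f" "square_summable g"
  shows "square_summable (\<lambda>x. f x + g x)"
  unfolding square_summable_def
proof (rule square_summable_bound[OF assms, where C = 2])
  fix x
  have "(cmod (f x + g x))\<^sup>2 \<le> (cmod (f x) + cmod (g x))\<^sup>2"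
    by (simp add: norm_triangle_ineq power_mono)
  also have "\<dots> \<le> 2 * ((cmod (f x))\<^sup>2 + (cmod (g x))\<^sup>2)"
    using sum_squares_bound[of "cmod (f x)" "cmod (g x)"] by (simp add: power2_sum)
  finally show "\<bar>(cmod (f x + g x))\<^sup>2\<bar> \<le> 2 * ((cmod (f x))\<^sup>2 + (cmod (g x))\<^sup>2)"
    by simp
qed

lemma square_summable_mult:
  assumes "square_summable f" "bounded (range w)"
  shows "square_summable (\<lambda>x. w x * f x)"
proof -
  obtain B where B: "\<And>x. cmod (w x) \<le> B"
    using assms(2) by (auto simp: bounded_iff)
  show ?thesis
    unfolding square_summable_def
  proof (rule square_summable_bound[OF assms(1) square_summable_0, where C = "B\<^sup>2"])
    fix x
    show "\<bar>(cmod (w x * f x))\<^sup>2\<bar> \<le> B\<^sup>2 * ((cmod (f x))\<^sup>2 + (cmod 0)\<^sup>2)"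
      using B[of x] by (simp add: norm_mult power_mult_distrib mult_right_mono power_mono)
  qed
qed

lemma square_summable_cmult:
  "square_summable f \<Longrightarrow> square_summable (\<lambda>x. c * f x)"
  by (rule square_summable_mult) (auto simp: image_constant_conv)

lemma square_summable_inner:
  assumes "square_summable f" "square_summable g"
  shows "(\<lambda>x. inner (f x) (g x)) summable_on UNIV"
proof (rule square_summable_bound[OF assms, where C = 1])
  fix x
  have *: "a * b \<le> a\<^sup>2 + b\<^sup>2" if "0 \<le> a" "0 \<le> b" for a b :: real
    using sum_squares_bound[of a b] mult_nonneg_nonneg[OF that] by linarith
  have "\<bar>inner (f x) (g x)\<bar> \<le> cmod (f x) * cmod (g x)"
    by (rule Cauchy_Schwarz_ineq2)
  also have "\<dots> \<le> 1 * ((cmod (f x))\<^sup>2 + (cmod (g x))\<^sup>2)"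
    using * by simp
  finally show "\<bar>inner (f x) (g x)\<bar> \<le> 1 * ((cmod (f x))\<^sup>2 + (cmod (g x))\<^sup>2)" .
qed

lemma square_summable_reindex:
  assumes "square_summable f" "inj h"
  shows "square_summable (\<lambda>x. f (h x))"
proof -
  have "(\<lambda>x. (cmod (f x))\<^sup>2) summable_on range h"
    using assms(1) unfolding square_summable_def
    by (rule summable_on_subset_banach) auto
  thus ?thesis
    using assms(2) by (simp add: square_summable_def summable_on_reindex o_def)
qed

typedef 'a ell2 = "{f :: 'a \<Rightarrow> complex. square_summable f}"
  morphisms ell2_apply Abs_ell2
  using square_summable_0 by blast

setup_lifting type_definition_ell2

lemma square_summable_apply: "square_summable (ell2_apply u)"
  using ell2_apply by blast

text \<open>
  The inner product below is the real part of the usual Hermitian inner product, so it induces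
  the usual norm. The complex vector space structure is the separate operation \<open>scaleC\<close>.
\<close>

instantiation ell2 :: (type) real_inner
begin

lift_definition zero_ell2 :: "'a ell2" is "\<lambda>_. 0"
  by (rule square_summable_0)

lift_definition plus_ell2 :: "'a ell2 \<Rightarrow> 'a ell2 \<Rightarrow> 'a ell2" is "\<lambda>f g x. f x + g x"
  by (rule square_summable_add)

lift_definition uminus_ell2 :: "'a ell2 \<Rightarrow> 'a ell2" is "\<lambda>f x. - f x"
  by (simp add: square_summable_def)

lift_definition minus_ell2 :: "'a ell2 \<Rightarrow> 'a ell2 \<Rightarrow> 'a ell2" is "\<lambda>f g x. f x - g x"
proof -
  fix f g :: "'a \<Rightarrow> complex"
  assume "square_summable f" "square_summable g"
  thus "square_summable (\<lambda>x. f x - g x)"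
    using square_summable_add[of f "\<lambda>x. - g x"] by (simp add: square_summable_def)
qed

lift_definition scaleR_ell2 :: "real \<Rightarrow> 'a ell2 \<Rightarrow> 'a ell2" is "\<lambda>r f x. r *\<^sub>R f x"
  unfolding scaleR_conv_of_real by (rule square_summable_cmult)

lift_definition inner_ell2 :: "'a ell2 \<Rightarrow> 'a ell2 \<Rightarrow> real" is
  "\<lambda>f g. \<Sum>\<^sub>\<infinity>x. inner (f x) (g x)" .

lift_definition norm_ell2 :: "'a ell2 \<Rightarrow> real" is
  "\<lambda>f. sqrt (\<Sum>\<^sub>\<infinity>x. (cmod (f x))\<^sup>2)" .

definition dist_ell2 :: "'a ell2 \<Rightarrow> 'a ell2 \<Rightarrow> real" where
  "dist_ell2 u v = norm (u - v)"

definition sgn_ell2 :: "'a ell2 \<Rightarrow> 'a ell2" where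
  "sgn_ell2 u = inverse (norm u) *\<^sub>R u"

definition uniformity_ell2 :: "('a ell2 \<times> 'a ell2) filter" where
  "uniformity_ell2 = (INF e\<in>{0<..}. principal {(u, v). dist u v < e})"

definition open_ell2 :: "'a ell2 set \<Rightarrow> bool" where
  "open_ell2 U \<longleftrightarrow> (\<forall>u\<in>U. \<forall>\<^sub>F (u', v) in uniformity. u' = u \<longrightarrow> v \<in> U)"

instance
proof
  fix u v w :: "'a ell2" and r s :: real
  show "u + v + w = u + (v + w)" by transfer (simp add: add.assoc)
  show "u + v = v + u" by transfer (simp add: add.commute)
  show "0 + u = u" by transfer simp
  show "- u + u = 0" by transfer simp
  show "u - v = u + - v" by transfer simp
  show "r *\<^sub>R (u + v) = r *\<^sub>R u + r *\<^sub>R v" by transfer (simp add: scaleR_add_right)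
  show "(r + s) *\<^sub>R u = r *\<^sub>R u + s *\<^sub>R u" by transfer (simp add: scaleR_add_left)
  show "r *\<^sub>R s *\<^sub>R u = (r * s) *\<^sub>R u" by transfer simp
  show "1 *\<^sub>R u = u" by transfer simp
  show "dist u v = norm (u - v)" by (rule dist_ell2_def)
  show "sgn u = inverse (norm u) *\<^sub>R u" by (rule sgn_ell2_def)
  show "inner u v = inner v u" by transfer (simp add: inner_commute)
  show "inner (u + v) w = inner u w + inner v w"
    by transfer (simp add: inner_add_left infsum_add square_summable_inner)
  show "inner (r *\<^sub>R u) v = r * inner u v"
    by transfer (simp add: infsum_cmult_right')
  show "0 \<le> inner u u" by transfer (simp add: infsum_nonneg)
  show "inner u u = 0 \<longleftrightarrow> u = 0"
  proof transfer
    fix f :: "'a \<Rightarrow> complex"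
    assume f: "square_summable f"
    show "(\<Sum>\<^sub>\<infinity>x. inner (f x) (f x)) = 0 \<longleftrightarrow> f = (\<lambda>_. 0)"
    proof
      assume "(\<Sum>\<^sub>\<infinity>x. inner (f x) (f x)) = 0"
      hence "inner (f x) (f x) = 0" for x
        by (intro nonneg_infsum_le_0D[where A = UNIV] square_summable_inner f) auto
      thus "f = (\<lambda>_. 0)" by auto
    qed simp
  qed
  show "norm u = sqrt (inner u u)"
    by transfer (simp add: power2_norm_eq_inner)
  show "(uniformity :: ('a ell2 \<times> 'a ell2) filter) =
      (INF e\<in>{0<..}. principal {(u, v). dist u v < e})"
    by (rule uniformity_ell2_def)
  show "open U \<longleftrightarrow> (\<forall>u\<in>U. \<forall>\<^sub>F (u', v) in uniformity. u' = u \<longrightarrow> v \<in> U)"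
    for U :: "'a ell2 set"
    by (rule open_ell2_def)
qed

end

lift_definition scaleC :: "complex \<Rightarrow> 'a ell2 \<Rightarrow> 'a ell2" (infixr "*\<^sub>C" 75) is
  "\<lambda>c f x. c * f x"
  by (rule square_summable_cmult)

interpretation ell2: vector_space "scaleC :: complex \<Rightarrow> 'a ell2 \<Rightarrow> 'a ell2"
proof
  fix a b :: complex and u v :: "'a ell2"
  show "a *\<^sub>C (u + v) = a *\<^sub>C u + a *\<^sub>C v" by transfer (simp add: distrib_left)
  show "(a + b) *\<^sub>C u = a *\<^sub>C u + b *\<^sub>C u" by transfer (simp add: distrib_right)
  show "a *\<^sub>C b *\<^sub>C u = (a * b) *\<^sub>C u" by transfer (simp add: mult.assoc)
  show "1 *\<^sub>C u = u" by transfer simp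
qed

section \<open>Spectrum and essential spectrum\<close>

definition bounded_clinear :: "('a ell2 \<Rightarrow> 'b ell2) \<Rightarrow> bool" where
  "bounded_clinear T \<longleftrightarrow> bounded_linear T \<and> (\<forall>c u. T (c *\<^sub>C u) = c *\<^sub>C T u)"

definition spectrum :: "('a ell2 \<Rightarrow> 'a ell2) \<Rightarrow> complex set" where
  "spectrum T = {z. \<not> (\<exists>R. bounded_clinear R \<and>
     (\<forall>u. R (T u - z *\<^sub>C u) = u) \<and> (\<forall>u. T (R u) - z *\<^sub>C R u = u))}"

text \<open>Finite-dimensional kernel, closed range, and range of finite codimension over \<open>\<complex>\<close>.\<close>

definition fredholm :: "('a ell2 \<Rightarrow> 'a ell2) \<Rightarrow> bool" where
  "fredholm T \<longleftrightarrow> bounded_clinear T \<and>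
     (\<exists>B. finite B \<and> {u. T u = 0} = ell2.span B) \<and>
     closed (range T) \<and>
     (\<exists>B. finite B \<and> ell2.span (range T \<union> B) = UNIV)"

definition essential_spectrum :: "('a ell2 \<Rightarrow> 'a ell2) \<Rightarrow> complex set" where
  "essential_spectrum T = {z. \<not> fredholm (\<lambda>u. T u - z *\<^sub>C u)}"

section \<open>Discrete Schroedinger operators\<close>

text \<open>
  The abstraction function \<open>Abs_ell2\<close> is only meaningful on square-summable arguments, so these
  operators are the intended ones only for bounded potentials; see the lemmas below.
\<close>

definition schrodinger_int :: "(int \<Rightarrow> real) \<Rightarrow> int ell2 \<Rightarrow> int ell2" where
  "schrodinger_int v u = Abs_ell2 (\<lambda>n.
     ell2_apply u (n + 1) + ell2_apply u (n - 1) + of_real (v n) * ell2_apply u n)"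

definition schrodinger_nat :: "(nat \<Rightarrow> real) \<Rightarrow> nat ell2 \<Rightarrow> nat ell2" where
  "schrodinger_nat v u = Abs_ell2 (\<lambda>n.
     ell2_apply u (n + 1) + (if n = 0 then 0 else ell2_apply u (n - 1))
       + of_real (v n) * ell2_apply u n)"

lemma bounded_range_of_real:
  "bounded (range v) \<Longrightarrow> bounded (range (\<lambda>n. complex_of_real (v n)))"
  by (auto simp: bounded_iff)

lemma ell2_apply_schrodinger_int:
  assumes "bounded (range v)"
  shows "ell2_apply (schrodinger_int v u) n =
    ell2_apply u (n + 1) + ell2_apply u (n - 1) + of_real (v n) * ell2_apply u n"
proof -
  have "square_summable (\<lambda>n.
    ell2_apply u (n + 1) + ell2_apply u (n - 1) + of_real (v n) * ell2_apply u n)"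
    by (intro square_summable_add square_summable_mult bounded_range_of_real assms
        square_summable_apply square_summable_reindex[OF square_summable_apply]) (auto simp: inj_def)
  thus ?thesis by (simp add: schrodinger_int_def Abs_ell2_inverse)
qed

lemma ell2_apply_schrodinger_nat:
  assumes "bounded (range v)"
  shows "ell2_apply (schrodinger_nat v u) n =
    ell2_apply u (n + 1) + (if n = 0 then 0 else ell2_apply u (n - 1))
      + of_real (v n) * ell2_apply u n"
proof -
  let ?g = "\<lambda>n. if n = 0 then 0 else ell2_apply u (n - 1)"
  have "(\<lambda>n. (cmod (?g n))\<^sup>2) summable_on range Suc"
    using square_summable_apply[of u] by (simp add: summable_on_reindex o_def square_summable_def)
  also have "?this \<longleftrightarrow> square_summable ?g"
    unfolding square_summable_def
    by (rule summable_on_cong_neutral) (auto simp: image_iff gr0_conv_Suc)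
  finally have "square_summable (\<lambda>n.
    ell2_apply u (n + 1) + ?g n + of_real (v n) * ell2_apply u n)"
    by (intro square_summable_add square_summable_mult bounded_range_of_real assms
        square_summable_apply square_summable_reindex[OF square_summable_apply]) (auto simp: inj_def)
  thus ?thesis by (simp add: schrodinger_nat_def Abs_ell2_inverse)
qed

end

theory Submission
  imports Defs
begin

text \<open>
  Write \<open>S\<close> for the whole-line and \<open>T\<close> for the half-line operator, both shifted by \<open>z\<close>. Since conjugation
  turns \<open>z\<close> into its conjugate, \<open>S\<close> is invertible iff it is bounded below. Since \<open>sqrt n\<close> varies slowly and
  the rotation by \<open>\<alpha>\<close> has dense orbits, on long windows far out the potential of \<open>T\<close> is close to a
  translate of the potential of \<open>S\<close>; and every long window of \<open>S\<close> recurs, up to a small error, far out in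
  \<open>T\<close>. If \<open>S\<close> is bounded below, then so is \<open>T\<close> on every far-out window, hence, by averaging over all
  windows of a fixed length, on all vectors supported far out, and this makes \<open>T\<close> Fredholm. Otherwise,
  finitely supported approximate eigenvectors of \<open>S\<close> can be moved arbitrarily far out in \<open>T\<close>, and then
  the range of \<open>T\<close> is not closed.
\<close>

section \<open>The Hilbert space of square-summable functions\<close>

lemmas ell2_rep_eq [simp] =
  zero_ell2.rep_eq plus_ell2.rep_eq uminus_ell2.rep_eq minus_ell2.rep_eq scaleR_ell2.rep_eq
  scaleC.rep_eq

lemma ell2_eqI: "(\<And>x. ell2_apply u x = ell2_apply v x) \<Longrightarrow> u = v"
  by (metis ell2_apply_inverse ext)

lemma square_summable_iff_bounded_sums:
  "square_summable f \<longleftrightarrow> (\<exists>B. \<forall>F. finite F \<longrightarrow> (\<Sum>x\<in>F. (cmod (f x))\<^sup>2) \<le> B)"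
proof
  assume "square_summable f"
  hence "(\<Sum>x\<in>F. (cmod (f x))\<^sup>2) \<le> (\<Sum>\<^sub>\<infinity>x. (cmod (f x))\<^sup>2)" if "finite F" for F
    using that unfolding square_summable_def by (intro finite_sum_le_infsum) auto
  thus "\<exists>B. \<forall>F. finite F \<longrightarrow> (\<Sum>x\<in>F. (cmod (f x))\<^sup>2) \<le> B" by blast
next
  assume "\<exists>B. \<forall>F. finite F \<longrightarrow> (\<Sum>x\<in>F. (cmod (f x))\<^sup>2) \<le> B"
  thus "square_summable f" unfolding square_summable_def
    by (intro nonneg_bdd_above_summable_on) (auto simp: bdd_above_def)
qed

lemma norm_ell2_power2: "(norm u)\<^sup>2 = (\<Sum>\<^sub>\<infinity>x. (cmod (ell2_apply u x))\<^sup>2)"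
  by (simp add: norm_ell2.rep_eq infsum_nonneg)

lemma sum_le_norm_ell2: "finite F \<Longrightarrow> (\<Sum>x\<in>F. (cmod (ell2_apply u x))\<^sup>2) \<le> (norm u)\<^sup>2"
  unfolding norm_ell2_power2 using square_summable_apply[of u]
  by (intro finite_sum_le_infsum) (auto simp: square_summable_def)

lemma norm_ell2_power2_leI:
  assumes "\<And>F. finite F \<Longrightarrow> (\<Sum>x\<in>F. (cmod (ell2_apply u x))\<^sup>2) \<le> B"
  shows "(norm u)\<^sup>2 \<le> B"
  unfolding norm_ell2_power2 using square_summable_apply[of u] assms
  by (intro infsum_le_finite_sums) (auto simp: square_summable_def)

lemma norm_ell2_leI:
  assumes "\<And>F. finite F \<Longrightarrow> (\<Sum>x\<in>F. (cmod (ell2_apply u x))\<^sup>2) \<le> B\<^sup>2" "0 \<le> B"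
  shows "norm u \<le> B"
  using norm_ell2_power2_leI[OF assms(1)] assms(2) by (rule power2_le_imp_le)

lemma norm_ell2_finite:
  assumes "finite F" "\<And>x. x \<notin> F \<Longrightarrow> ell2_apply u x = 0"
  shows "(norm u)\<^sup>2 = (\<Sum>x\<in>F. (cmod (ell2_apply u x))\<^sup>2)"
proof -
  have "(\<Sum>\<^sub>\<infinity>x. (cmod (ell2_apply u x))\<^sup>2) = (\<Sum>\<^sub>\<infinity>x\<in>F. (cmod (ell2_apply u x))\<^sup>2)"
    by (rule infsum_cong_neutral) (use assms(2) in auto)
  thus ?thesis using assms(1) by (simp add: norm_ell2_power2)
qed

lemma cmod_le_norm_ell2: "cmod (ell2_apply u x) \<le> norm u"
  by (rule power2_le_imp_le) (use sum_le_norm_ell2[of "{x}" u] in simp_all)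

lemma norm_ell2_mono:
  assumes "\<And>x. cmod (ell2_apply u x) \<le> C * cmod (ell2_apply w x)" "0 \<le> C"
  shows "norm u \<le> C * norm w"
proof (rule norm_ell2_leI)
  fix F :: "'a set"
  assume F: "finite F"
  have "(\<Sum>x\<in>F. (cmod (ell2_apply u x))\<^sup>2) \<le> (\<Sum>x\<in>F. C\<^sup>2 * (cmod (ell2_apply w x))\<^sup>2)"
    using assms by (intro sum_mono) (metis norm_ge_zero power_mono power_mult_distrib)
  also have "\<dots> = C\<^sup>2 * (\<Sum>x\<in>F. (cmod (ell2_apply w x))\<^sup>2)"
    by (simp add: sum_distrib_left)
  also have "\<dots> \<le> C\<^sup>2 * (norm w)\<^sup>2"
    by (intro mult_left_mono sum_le_norm_ell2 F) auto
  finally show "(\<Sum>x\<in>F. (cmod (ell2_apply u x))\<^sup>2) \<le> (C * norm w)\<^sup>2"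
    by (simp add: power_mult_distrib)
qed (use assms in auto)

lemma norm_scaleC: "norm (c *\<^sub>C u) = cmod c * norm u"
proof -
  have "(norm (c *\<^sub>C u))\<^sup>2 = (cmod c * norm u)\<^sup>2"
    unfolding power_mult_distrib norm_ell2_power2
    by (simp add: norm_mult power_mult_distrib infsum_cmult_right')
  thus ?thesis by simp
qed

lemma scaleR_scaleC: "r *\<^sub>R u = of_real r *\<^sub>C u"
  by (rule ell2_eqI) (simp add: scaleR_conv_of_real)

lemma bounded_clinearI:
  assumes "\<And>u w. T (u + w) = T u + T w" "\<And>c u. T (c *\<^sub>C u) = c *\<^sub>C T u"
    and "\<And>u. norm (T u) \<le> K * norm u"
  shows "bounded_clinear T"
  unfolding bounded_clinear_def
  using assms by (auto simp: scaleR_scaleC mult.commute intro!: bounded_linear_intro[where K = K])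

text \<open>The limit is formed coordinatewise. Bounds on finite sums survive this limit, and they
  are uniform in the finite set, so they give both square summability of the limit and convergence
  in norm.\<close>

instance ell2 :: (type) banach
proof
  fix X :: "nat \<Rightarrow> 'a ell2"
  assume "Cauchy X"
  have "Cauchy (\<lambda>n. ell2_apply (X n) x)" for x
  proof (rule CauchyI)
    fix e :: real assume "0 < e"
    then obtain M where "\<forall>m\<ge>M. \<forall>n\<ge>M. norm (X m - X n) < e"
      using \<open>Cauchy X\<close> CauchyD by blast
    thus "\<exists>M. \<forall>m\<ge>M. \<forall>n\<ge>M. cmod (ell2_apply (X m) x - ell2_apply (X n) x) < e"
      by (metis cmod_le_norm_ell2 le_less_trans minus_ell2.rep_eq)
  qed
  hence "\<forall>x. \<exists>l. (\<lambda>n. ell2_apply (X n) x) \<longlonglongrightarrow> l"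
    by (simp add: Cauchy_convergent_iff convergent_def)
  then obtain g where g: "\<And>x. (\<lambda>n. ell2_apply (X n) x) \<longlonglongrightarrow> g x"
    by metis
  have bound: "\<exists>M. \<forall>n\<ge>M. \<forall>F. finite F \<longrightarrow> (\<Sum>x\<in>F. (cmod (ell2_apply (X n) x - g x))\<^sup>2) \<le> e\<^sup>2"
    if "0 < e" for e
  proof -
    obtain M where M: "\<And>m n. m \<ge> M \<Longrightarrow> n \<ge> M \<Longrightarrow> norm (X n - X m) < e"
      using \<open>Cauchy X\<close> CauchyD \<open>0 < e\<close> by blast
    show ?thesis
    proof (intro exI allI impI)
      fix n F assume n: "n \<ge> M" and F: "finite (F :: 'a set)"
      show "(\<Sum>x\<in>F. (cmod (ell2_apply (X n) x - g x))\<^sup>2) \<le> e\<^sup>2"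
      proof (rule LIMSEQ_le_const2)
        show "(\<lambda>m. \<Sum>x\<in>F. (cmod (ell2_apply (X n) x - ell2_apply (X m) x))\<^sup>2)
            \<longlonglongrightarrow> (\<Sum>x\<in>F. (cmod (ell2_apply (X n) x - g x))\<^sup>2)"
          by (intro tendsto_intros g)
        show "\<exists>N. \<forall>m\<ge>N. (\<Sum>x\<in>F. (cmod (ell2_apply (X n) x - ell2_apply (X m) x))\<^sup>2) \<le> e\<^sup>2"
        proof (intro exI allI impI)
          fix m assume "m \<ge> M"
          have "(\<Sum>x\<in>F. (cmod (ell2_apply (X n - X m) x))\<^sup>2) \<le> (norm (X n - X m))\<^sup>2"
            by (rule sum_le_norm_ell2[OF F])
          also have "\<dots> \<le> e\<^sup>2"
            using M[OF \<open>m \<ge> M\<close> n] by (intro power_mono) auto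
          finally show "(\<Sum>x\<in>F. (cmod (ell2_apply (X n) x - ell2_apply (X m) x))\<^sup>2) \<le> e\<^sup>2"
            by simp
        qed
      qed
    qed
  qed
  from bound[of 1] obtain M where
    M: "\<And>F. finite F \<Longrightarrow> (\<Sum>x\<in>F. (cmod (ell2_apply (X M) x - g x))\<^sup>2) \<le> 1"
    by (metis less_numeral_extra(1) order_refl power_one)
  have "square_summable (\<lambda>x. ell2_apply (X M) x - g x)"
    unfolding square_summable_iff_bounded_sums using M by blast
  from square_summable_add[OF square_summable_apply[of "X M"] square_summable_cmult[OF this, of "-1"]]
  have "square_summable g" by simp
  hence G: "ell2_apply (Abs_ell2 g) = g" by (simp add: Abs_ell2_inverse)
  have "X \<longlonglongrightarrow> Abs_ell2 g"
  proof (rule LIMSEQ_I)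
    fix e :: real assume "0 < e"
    hence "0 < e / 2" by simp
    from bound[OF this] obtain M where M: "\<And>n F. n \<ge> M \<Longrightarrow> finite F \<Longrightarrow>
        (\<Sum>x\<in>F. (cmod (ell2_apply (X n) x - g x))\<^sup>2) \<le> (e / 2)\<^sup>2" by blast
    have "norm (X n - Abs_ell2 g) \<le> e / 2" if "n \<ge> M" for n
      by (rule norm_ell2_leI) (use M that \<open>0 < e\<close> in \<open>auto simp: G\<close>)
    thus "\<exists>M. \<forall>n\<ge>M. norm (X n - Abs_ell2 g) < e"
      using \<open>0 < e\<close> by (intro exI[of _ M]) (smt (verit) field_sum_of_halves)
  qed
  thus "convergent X" by (auto simp: convergent_def)
qed

section \<open>Conjugation, pull-backs and finite truncations\<close>

lift_definition ell2_cnj :: "'a ell2 \<Rightarrow> 'a ell2" is "\<lambda>f x. cnj (f x)"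
  by (simp add: square_summable_def)

lemma norm_ell2_cnj [simp]: "norm (ell2_cnj u) = norm u"
  by transfer simp

lemma ell2_cnj_eq_0_iff [simp]: "ell2_cnj u = 0 \<longleftrightarrow> u = 0"
  by (metis norm_ell2_cnj norm_eq_zero)

text \<open>One encoding for all cut-offs and translations: the identity as \<open>g\<close> gives
  restrictions, \<open>S = UNIV\<close> the forward hopping term, and \<open>g = inv s\<close> on
  \<open>S = range s\<close> the backward one, where the value \<open>0\<close> off \<open>S\<close>
  is the convention at the boundary of the half-line.\<close>

definition ell2_pull :: "'b set \<Rightarrow> ('b \<Rightarrow> 'a) \<Rightarrow> 'a ell2 \<Rightarrow> 'b ell2" where
  "ell2_pull S g u = Abs_ell2 (\<lambda>x. if x \<in> S then ell2_apply u (g x) else 0)"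

lemma sum_ell2_pull_le:
  assumes "inj_on g S" "finite F"
  shows "(\<Sum>x\<in>F. (cmod (if x \<in> S then ell2_apply u (g x) else 0))\<^sup>2) \<le> (norm u)\<^sup>2"
proof -
  have "(\<Sum>x\<in>F. (cmod (if x \<in> S then ell2_apply u (g x) else 0))\<^sup>2)
      = (\<Sum>x\<in>F \<inter> S. (cmod (ell2_apply u (g x)))\<^sup>2)"
    using assms(2) by (intro sum.mono_neutral_cong_right) auto
  also have "\<dots> = (\<Sum>y\<in>g ` (F \<inter> S). (cmod (ell2_apply u y))\<^sup>2)"
    using assms(1) by (subst sum.reindex) (auto simp: inj_on_def)
  also have "\<dots> \<le> (norm u)\<^sup>2"
    using assms(2) by (intro sum_le_norm_ell2) auto
  finally show ?thesis .
qed

lemma ell2_apply_pull: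
  assumes "inj_on g S"
  shows "ell2_apply (ell2_pull S g u) x = (if x \<in> S then ell2_apply u (g x) else 0)"
proof -
  have "square_summable (\<lambda>x. if x \<in> S then ell2_apply u (g x) else 0)"
    unfolding square_summable_iff_bounded_sums using sum_ell2_pull_le[OF assms] by blast
  thus ?thesis by (simp add: ell2_pull_def Abs_ell2_inverse)
qed

lemma norm_pull_le:
  assumes "inj_on g S"
  shows "norm (ell2_pull S g u) \<le> norm u"
  by (rule norm_ell2_leI) (use sum_ell2_pull_le[OF assms] in \<open>auto simp: ell2_apply_pull[OF assms]\<close>)

lemma norm_pull_eq:
  assumes "inj_on g S" "\<And>y. y \<notin> g ` S \<Longrightarrow> ell2_apply u y = 0"
  shows "norm (ell2_pull S g u) = norm u"
proof -
  have "(norm (ell2_pull S g u))\<^sup>2 = (\<Sum>\<^sub>\<infinity>x\<in>S. (cmod (ell2_apply u (g x)))\<^sup>2)"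
    unfolding norm_ell2_power2
    by (rule infsum_cong_neutral) (auto simp: ell2_apply_pull[OF assms(1)])
  also have "\<dots> = (\<Sum>\<^sub>\<infinity>y\<in>g ` S. (cmod (ell2_apply u y))\<^sup>2)"
    by (simp add: infsum_reindex[OF assms(1)] o_def)
  also have "\<dots> = (norm u)\<^sup>2"
    unfolding norm_ell2_power2 by (rule infsum_cong_neutral) (use assms(2) in auto)
  finally show ?thesis by simp
qed

abbreviation ell2_restrict :: "'a set \<Rightarrow> 'a ell2 \<Rightarrow> 'a ell2" where
  "ell2_restrict S \<equiv> ell2_pull S (\<lambda>x. x)"

lemmas ell2_apply_restrict [simp] = ell2_apply_pull[OF inj_on_id2]

lemma finite_restriction_approx:
  assumes "0 < e"
  shows "\<exists>F. finite F \<and> (\<forall>G. finite G \<longrightarrow> F \<subseteq> G \<longrightarrow> norm (u - ell2_restrict G u) < e)"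
proof -
  let ?f = "\<lambda>x. (cmod (ell2_apply u x))\<^sup>2"
  have "(?f has_sum (norm u)\<^sup>2) UNIV"
    unfolding norm_ell2_power2 using square_summable_apply[of u]
    by (simp add: square_summable_def)
  hence "\<forall>\<^sub>F G in finite_subsets_at_top UNIV. (norm u)\<^sup>2 - e\<^sup>2 / 2 < sum ?f G"
    unfolding has_sum_def using assms by (intro order_tendstoD) auto
  then obtain F where F: "finite F"
    "\<And>G. finite G \<Longrightarrow> F \<subseteq> G \<Longrightarrow> (norm u)\<^sup>2 - e\<^sup>2 / 2 < sum ?f G"
    by (auto simp: eventually_finite_subsets_at_top)
  have "norm (u - ell2_restrict G u) < e" if G: "finite G" "F \<subseteq> G" for G
  proof -
    \<comment> \<open>Bounds obtained from finite sums are only non-strict; aiming at half of the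
      squared error recovers the strict inequality.\<close>
    have "(norm (u - ell2_restrict G u))\<^sup>2 \<le> e\<^sup>2 / 2"
    proof (rule norm_ell2_power2_leI)
      fix A :: "'a set" assume A: "finite A"
      have "(\<Sum>x\<in>A. (cmod (ell2_apply (u - ell2_restrict G u) x))\<^sup>2) = sum ?f (A - G)"
        using A by (intro sum.mono_neutral_cong_right) auto
      also have "\<dots> = sum ?f ((A - G) \<union> G) - sum ?f G"
        using A G by (subst sum.union_disjoint) auto
      also have "\<dots> \<le> (norm u)\<^sup>2 - sum ?f G"
        using A G by (intro diff_right_mono sum_le_norm_ell2) auto
      also have "\<dots> \<le> e\<^sup>2 / 2" using F(2)[OF G] by simp
      finally show "(\<Sum>x\<in>A. (cmod (ell2_apply (u - ell2_restrict G u) x))\<^sup>2) \<le> e\<^sup>2 / 2" .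
    qed
    also have "\<dots> < e\<^sup>2" using assms by simp
    finally show ?thesis using assms by (simp add: power_less_imp_less_base)
  qed
  with F(1) show ?thesis by blast
qed

section \<open>Multiplication operators and adjoints\<close>

definition ell2_mult :: "('a \<Rightarrow> real) \<Rightarrow> 'a ell2 \<Rightarrow> 'a ell2" where
  "ell2_mult v u = Abs_ell2 (\<lambda>x. of_real (v x) * ell2_apply u x)"

lemma ell2_apply_mult:
  assumes "bounded (range v)"
  shows "ell2_apply (ell2_mult v u) x = of_real (v x) * ell2_apply u x"
  using square_summable_mult[OF square_summable_apply bounded_range_of_real[OF assms]]
  by (simp add: ell2_mult_def Abs_ell2_inverse)

lemma inner_ell2_eq: "inner u w = (\<Sum>\<^sub>\<infinity>x. inner (ell2_apply u x) (ell2_apply w x))"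
  by (simp add: inner_ell2.rep_eq)

text \<open>Reindexing the sum along \<open>s\<close> makes the two hopping terms of a Schroedinger
  operator adjoint to each other.\<close>

lemma inner_pull_left:
  assumes "inj s"
  shows "inner (ell2_pull UNIV s u) w = inner u (ell2_pull (range s) (inv s) w)"
proof -
  have "inj_on (inv s) (range s)" by (rule inj_on_inv_into) simp
  hence "inner u (ell2_pull (range s) (inv s) w)
      = (\<Sum>\<^sub>\<infinity>x\<in>range s. inner (ell2_apply u x) (ell2_apply w (inv s x)))"
    unfolding inner_ell2_eq by (intro infsum_cong_neutral) (auto simp: ell2_apply_pull)
  also have "\<dots> = inner (ell2_pull UNIV s u) w"
    unfolding inner_ell2_eq
    by (simp add: infsum_reindex[OF assms] o_def ell2_apply_pull[OF assms] inv_f_f[OF assms])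
  finally show ?thesis ..
qed

lemma inner_scaleC: "inner (c *\<^sub>C u) w = inner u (cnj c *\<^sub>C w)"
  unfolding inner_ell2_eq by (intro infsum_cong) (simp add: inner_complex_def algebra_simps)

lemma inner_ell2_mult:
  assumes "bounded (range v)"
  shows "inner (ell2_mult v u) w = inner u (ell2_mult v w)"
  unfolding inner_ell2_eq
  by (intro infsum_cong) (simp add: inner_complex_def ell2_apply_mult[OF assms] algebra_simps)

section \<open>Closed subspaces of Hilbert spaces\<close>

text \<open>A minimising sequence for the distance from \<open>x\<close> to \<open>M\<close> is
  Cauchy by the parallelogram law, because midpoints stay in \<open>M\<close>. Varying its limit
  along \<open>y\<close> gives orthogonality.\<close>

lemma orthogonal_projection_exists:
  fixes M :: "'a :: {real_inner, complete_space} set"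
  assumes "subspace M" "closed M"
  shows "\<exists>m\<in>M. \<forall>y\<in>M. inner (x - m) y = 0"
proof -
  define d where "d = infdist x M"
  have "0 \<in> M" using assms(1) subspace_0 by blast
  hence "M \<noteq> {}" by blast
  have d0: "0 \<le> d" by (simp add: d_def infdist_nonneg)
  have dle: "d\<^sup>2 \<le> (norm (x - y))\<^sup>2" if "y \<in> M" for y
    using infdist_le[OF that, of x] d0 by (intro power_mono) (auto simp: d_def dist_norm)
  have "\<exists>y\<in>M. (norm (x - y))\<^sup>2 < d\<^sup>2 + inverse (real (Suc k))" for k
  proof -
    let ?r = "sqrt (d\<^sup>2 + inverse (real (Suc k)))"
    have "d < ?r" by (rule real_less_rsqrt) simp
    then obtain y where "y \<in> M" "dist x y < ?r"
      using \<open>M \<noteq> {}\<close> unfolding d_def infdist_notempty[OF \<open>M \<noteq> {}\<close>]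
      by (subst (asm) cINF_less_iff) auto
    moreover from this have "(norm (x - y))\<^sup>2 < ?r\<^sup>2"
      by (intro power_strict_mono) (auto simp: dist_norm)
    ultimately show ?thesis by (auto simp: add_nonneg_pos less_imp_le)
  qed
  then obtain Y where Y: "\<And>k. Y k \<in> M" "\<And>k. (norm (x - Y k))\<^sup>2 < d\<^sup>2 + inverse (real (Suc k))"
    by metis
  have dist2: "(norm (Y j - Y k))\<^sup>2 \<le> 2 * inverse (real (Suc j)) + 2 * inverse (real (Suc k))" for j k
  proof -
    have "(1/2) *\<^sub>R (Y j + Y k) \<in> M"
      using assms(1) Y(1) by (simp add: subspace_add subspace_scale)
    from dle[OF this] have "4 * d\<^sup>2 \<le> (norm (2 *\<^sub>R (x - (1/2) *\<^sub>R (Y j + Y k))))\<^sup>2"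
      by (simp only: norm_scaleR power_mult_distrib) simp
    also have "2 *\<^sub>R (x - (1/2) *\<^sub>R (Y j + Y k)) = (x - Y j) + (x - Y k)"
      by (simp add: algebra_simps scaleR_2)
    finally have "4 * d\<^sup>2 \<le> (norm ((x - Y j) + (x - Y k)))\<^sup>2" .
    moreover have "(norm ((x - Y j) + (x - Y k)))\<^sup>2 + (norm ((x - Y k) - (x - Y j)))\<^sup>2
        = 2 * (norm (x - Y j))\<^sup>2 + 2 * (norm (x - Y k))\<^sup>2"
      unfolding power2_norm_eq_inner by (simp only: inner_add inner_diff) (simp add: inner_commute)
    ultimately show ?thesis using Y(2)[of j] Y(2)[of k] by simp
  qed
  have "Cauchy Y"
  proof (rule CauchyI)
    fix e :: real assume "0 < e"
    hence "0 < e\<^sup>2 / 4" by simp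
    then obtain N where N: "inverse (real (Suc N)) < e\<^sup>2 / 4"
      using reals_Archimedean by blast
    have "norm (Y j - Y k) < e" if "j \<ge> N" "k \<ge> N" for j k
    proof (rule power_less_imp_less_base)
      have "inverse (real (Suc j)) \<le> inverse (real (Suc N))"
        "inverse (real (Suc k)) \<le> inverse (real (Suc N))"
        using that by (auto intro!: le_imp_inverse_le)
      thus "(norm (Y j - Y k))\<^sup>2 < e\<^sup>2" using dist2[of j k] N by linarith
    qed (use \<open>0 < e\<close> in simp)
    thus "\<exists>N. \<forall>j\<ge>N. \<forall>k\<ge>N. norm (Y j - Y k) < e" by blast
  qed
  then obtain m where m: "Y \<longlonglongrightarrow> m" using Cauchy_convergent_iff convergent_def by blast
  have "m \<in> M" using assms(2) Y(1) m closed_sequentially by blast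
  have "(norm (x - m))\<^sup>2 \<le> d\<^sup>2 + 0"
  proof (rule LIMSEQ_le)
    show "(\<lambda>k. (norm (x - Y k))\<^sup>2) \<longlonglongrightarrow> (norm (x - m))\<^sup>2" by (intro tendsto_intros m)
    show "(\<lambda>k. d\<^sup>2 + inverse (real (Suc k))) \<longlonglongrightarrow> d\<^sup>2 + 0"
      by (intro tendsto_intros LIMSEQ_inverse_real_of_nat)
  qed (use Y(2) in \<open>auto intro: less_imp_le\<close>)
  have "inner (x - m) y = 0" if "y \<in> M" for y
  proof (cases "y = 0")
    case False
    \<comment> \<open>This \<open>t\<close> minimises the norm of
      \<open>(x - m) - t *\<^sub>R y\<close>, so a nonzero value would contradict the minimality of
      \<open>m\<close>.\<close>
    define t where "t = inner (x - m) y / inner y y"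
    have "m + t *\<^sub>R y \<in> M" using assms(1) \<open>m \<in> M\<close> that by (simp add: subspace_add subspace_scale)
    from dle[OF this] \<open>(norm (x - m))\<^sup>2 \<le> d\<^sup>2 + 0\<close>
    have "(norm (x - m))\<^sup>2 \<le> (norm (x - (m + t *\<^sub>R y)))\<^sup>2" by linarith
    also have "x - (m + t *\<^sub>R y) = (x - m) - t *\<^sub>R y" by simp
    also have "(norm ((x - m) - t *\<^sub>R y))\<^sup>2 = (norm (x - m))\<^sup>2 - 2 * t * inner (x - m) y + t * t * inner y y"
      unfolding power2_norm_eq_inner inner_diff_left[of "x - m"] inner_diff_right[of _ "x - m"]
      by (simp add: inner_commute algebra_simps)
    also have "\<dots> = (norm (x - m))\<^sup>2 - t * t * inner y y"
      using False by (simp add: t_def)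
    finally have "t * t * inner y y \<le> 0" by simp
    moreover have "0 < inner y y" using False by simp
    ultimately have "t * t \<le> 0" by (simp only: mult_le_0_iff) auto
    hence "t = 0" by (auto simp: mult_le_0_iff)
    thus ?thesis using False by (simp add: t_def)
  qed simp
  with \<open>m \<in> M\<close> show ?thesis by blast
qed

text \<open>After replacing \<open>v\<close> by its component orthogonal to \<open>M\<close>, membership in \<open>M + \<real> v\<close> becomes
  membership of \<open>x - (x, v) / (v, v) v\<close> in \<open>M\<close>, a closed condition on \<open>x\<close>.\<close>

lemma closed_subspace_add_line:
  fixes M :: "'a :: {real_inner, complete_space} set"
  assumes "subspace M" "closed M"
  shows "closed {m + r *\<^sub>R v |m r. m \<in> M}"
proof -
  obtain p where p: "p \<in> M" "\<And>y. y \<in> M \<Longrightarrow> inner (v - p) y = 0"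
    using orthogonal_projection_exists[OF assms] by blast
  define w where "w = v - p"
  \<comment> \<open>If \<open>v\<close> lies in \<open>M\<close>, then \<open>w = 0\<close>, and
    \<open>f\<close> is the identity, in accordance with the line adding nothing to
    \<open>M\<close>.\<close>
  define f where "f x = x - (inner x w / inner w w) *\<^sub>R w" for x
  have "{m + r *\<^sub>R v |m r. m \<in> M} = f -` M"
  proof (intro equalityI subsetI)
    fix x assume "x \<in> {m + r *\<^sub>R v |m r. m \<in> M}"
    then obtain m r where x: "x = m + r *\<^sub>R v" "m \<in> M" by blast
    have "x = (m + r *\<^sub>R p) + r *\<^sub>R w" by (simp add: x w_def algebra_simps)
    moreover have "m + r *\<^sub>R p \<in> M" using assms(1) p x by (simp add: subspace_add subspace_scale)
    moreover from this have "inner (m + r *\<^sub>R p) w = 0" using p(2) by (metis inner_commute w_def)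
    ultimately show "x \<in> f -` M" by (cases "w = 0") (simp_all add: f_def inner_add_left)
  next
    fix x assume "x \<in> f -` M"
    hence "f x - (inner x w / inner w w) *\<^sub>R p \<in> M"
      using assms(1) p by (simp add: subspace_diff subspace_scale)
    moreover have "x = (f x - (inner x w / inner w w) *\<^sub>R p) + (inner x w / inner w w) *\<^sub>R v"
      by (simp add: f_def w_def algebra_simps)
    ultimately show "x \<in> {m + r *\<^sub>R v |m r. m \<in> M}" by blast
  qed
  moreover have "closed (f -` M)"
  proof (rule closed_vimage[OF assms(2)])
    show "continuous_on UNIV f"
    proof (cases "w = 0")
      case True
      thus ?thesis by (simp add: f_def)
    next
      case False
      thus ?thesis unfolding f_def by (intro continuous_intros) auto
    qed
  qed
  ultimately show ?thesis by simp
qed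

lemma subspace_add_line:
  assumes "subspace M"
  shows "subspace {m + r *\<^sub>R v |m r. m \<in> M}"
proof -
  have "subspace (range (\<lambda>r. r *\<^sub>R v))"
    by (rule linear_subspace_image) (auto simp: linear_iff algebra_simps)
  from subspace_sums[OF assms this]
  have "subspace {x + y |x y. x \<in> M \<and> y \<in> range (\<lambda>r. r *\<^sub>R v)}" .
  also have "{x + y |x y. x \<in> M \<and> y \<in> range (\<lambda>r. r *\<^sub>R v)} = {m + r *\<^sub>R v |m r. m \<in> M}"
    by blast
  finally show ?thesis .
qed

section \<open>Discrete Schroedinger operators along an injection\<close>

text \<open>The successor map on the integers and on the naturals yields the two operators of the
  theorem, shifted by \<open>z\<close>.\<close>

definition shifted_op :: "('a \<Rightarrow> 'a) \<Rightarrow> ('a \<Rightarrow> real) \<Rightarrow> complex \<Rightarrow> 'a ell2 \<Rightarrow> 'a ell2" where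
  "shifted_op s v z u =
     ell2_pull UNIV s u + ell2_pull (range s) (inv s) u + ell2_mult v u - z *\<^sub>C u"

context
  fixes s :: "'a \<Rightarrow> 'a" and v :: "'a \<Rightarrow> real"
  assumes inj: "inj s" and bdd: "bounded (range v)"
begin

lemma inj_on_inv_range: "inj_on (inv s) (range s)"
  by (rule inj_on_inv_into) simp

lemma ell2_apply_shifted_op:
  "ell2_apply (shifted_op s v z u) x = ell2_apply u (s x)
     + (if x \<in> range s then ell2_apply u (inv s x) else 0) + (of_real (v x) - z) * ell2_apply u x"
  by (simp add: shifted_op_def ell2_apply_pull[OF inj] ell2_apply_pull[OF inj_on_inv_range]
      ell2_apply_mult[OF bdd] left_diff_distrib)

lemma bounded_clinear_shifted_op: "bounded_clinear (shifted_op s v z)"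
proof -
  obtain B where B: "\<And>x. \<bar>v x\<bar> \<le> B" using bdd by (auto simp: bounded_iff)
  have "0 \<le> B" using B[of undefined] by linarith
  show ?thesis
  proof (rule bounded_clinearI)
    show "shifted_op s v z (u + w) = shifted_op s v z u + shifted_op s v z w" for u w
      by (rule ell2_eqI) (simp add: ell2_apply_shifted_op algebra_simps)
    show "shifted_op s v z (c *\<^sub>C u) = c *\<^sub>C shifted_op s v z u" for c u
      by (rule ell2_eqI) (simp add: ell2_apply_shifted_op algebra_simps)
    show "norm (shifted_op s v z u) \<le> (2 + B + cmod z) * norm u" for u
    proof -
      have "norm (ell2_mult v u) \<le> B * norm u"
        using B \<open>0 \<le> B\<close>
        by (intro norm_ell2_mono) (auto simp: ell2_apply_mult[OF bdd] norm_mult intro: mult_right_mono)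
      moreover have "norm (ell2_pull UNIV s u) \<le> norm u" "norm (ell2_pull (range s) (inv s) u) \<le> norm u"
        by (intro norm_pull_le inj inj_on_inv_range)+
      moreover have "norm (shifted_op s v z u) \<le> norm (ell2_pull UNIV s u)
          + norm (ell2_pull (range s) (inv s) u) + norm (ell2_mult v u) + norm (z *\<^sub>C u)"
        unfolding shifted_op_def
        by (intro order_trans[OF norm_triangle_ineq4] add_mono order_trans[OF norm_triangle_ineq]
            order_refl)
      ultimately show ?thesis by (simp add: norm_scaleC algebra_simps)
    qed
  qed
qed

lemma bounded_linear_shifted_op: "bounded_linear (shifted_op s v z)"
  using bounded_clinear_shifted_op by (simp add: bounded_clinear_def)

lemma shifted_op_cnj: "shifted_op s v z (ell2_cnj u) = ell2_cnj (shifted_op s v (cnj z) u)"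
  by (rule ell2_eqI) (simp add: ell2_apply_shifted_op ell2_cnj.rep_eq)

text \<open>The potential is real and the hopping terms are mutually adjoint, so passing to the
  adjoint only conjugates \<open>z\<close>.\<close>

lemma inner_shifted_op: "inner (shifted_op s v z u) w = inner u (shifted_op s v (cnj z) w)"
proof -
  have "inner (ell2_pull (range s) (inv s) u) w = inner u (ell2_pull UNIV s w)"
    by (metis inner_commute inner_pull_left[OF inj])
  thus ?thesis
    by (simp add: shifted_op_def inner_add_left inner_add_right inner_diff_left inner_diff_right
        inner_pull_left[OF inj] inner_ell2_mult[OF bdd] inner_scaleC)
qed

text \<open>Testing against the image of \<open>shifted_op s v (cnj z) w\<close> puts
  \<open>w\<close> in the kernel for \<open>cnj z\<close>; conjugation carries it to the kernel for
  \<open>z\<close>. Thus the kernel for \<open>z\<close> also controls the orthogonal complement of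
  the range for the same \<open>z\<close>, even if \<open>z\<close> is not real.\<close>

lemma orthogonal_range_shifted_op:
  assumes "\<And>u. inner w (shifted_op s v z u) = 0"
  shows "shifted_op s v z (ell2_cnj w) = 0"
proof -
  have "inner (shifted_op s v (cnj z) w) (shifted_op s v (cnj z) w) = 0"
    using assms by (simp add: inner_shifted_op)
  thus ?thesis by (simp add: shifted_op_cnj)
qed

lemma subspace_range_shifted_op: "subspace (range (shifted_op s v z))"
  using bounded_linear_shifted_op by (intro linear_subspace_image) (auto simp: bounded_linear.linear)

text \<open>A lower bound gives trivial kernel and closed range. A vector orthogonal to the range is
  then the conjugate of a kernel element, hence \<open>0\<close>, so the operator is onto and its
  inverse is bounded by \<open>inverse c\<close>. Conversely, a bound for the inverse is a lower
  bound for the operator.\<close>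

lemma spectrum_shifted_op:
  assumes "\<And>u. T u - z *\<^sub>C u = shifted_op s v z u"
  shows "z \<notin> spectrum T \<longleftrightarrow> (\<exists>c>0. \<forall>u. c * norm u \<le> norm (shifted_op s v z u))"
proof
  assume "z \<notin> spectrum T"
  then obtain R where "bounded_clinear R" and R: "\<And>u. R (shifted_op s v z u) = u"
    by (auto simp: spectrum_def assms)
  then obtain K where K: "0 < K" "\<And>u. norm (R u) \<le> norm u * K"
    using bounded_linear.pos_bounded unfolding bounded_clinear_def by blast
  have "inverse K * norm u \<le> norm (shifted_op s v z u)" for u
    using K(2)[of "shifted_op s v z u"] K(1) by (simp add: R field_simps)
  with K(1) show "\<exists>c>0. \<forall>u. c * norm u \<le> norm (shifted_op s v z u)"
    by (intro exI[of _ "inverse K"]) auto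
next
  let ?T = "shifted_op s v z"
  assume "\<exists>c>0. \<forall>u. c * norm u \<le> norm (?T u)"
  then obtain c where c: "0 < c" "\<And>u. c * norm u \<le> norm (?T u)" by blast
  have ker: "u = 0" if "?T u = 0" for u
    using c(2)[of u] c(1) that by (simp add: mult_le_0_iff)
  interpret T: bounded_linear ?T by (rule bounded_linear_shifted_op)
  have "inj ?T"
  proof (rule injI)
    fix u w assume "?T u = ?T w"
    hence "?T (u - w) = 0" by (simp add: T.diff)
    thus "u = w" using ker by fastforce
  qed
  have "complete (range ?T)"
    using c by (intro complete_isometric_image[of c] T.bounded_linear_axioms) auto
  hence closed: "closed (range ?T)" by (rule complete_imp_closed)
  have "y \<in> range ?T" for y
  proof -
    obtain m where m: "m \<in> range ?T" "\<And>u. inner (y - m) (?T u) = 0"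
      using orthogonal_projection_exists[OF subspace_range_shifted_op closed, of y] by blast
    have "?T (ell2_cnj (y - m)) = 0" using m(2) by (rule orthogonal_range_shifted_op)
    hence "y = m" using ker by fastforce
    with m(1) show ?thesis by simp
  qed
  hence "surj ?T" by blast
  define R where "R = inv ?T"
  have TR: "?T (R u) = u" and RT: "R (?T u) = u" for u
    using \<open>surj ?T\<close> \<open>inj ?T\<close> by (simp_all add: R_def surj_f_inv_f)
  have "bounded_clinear R"
  proof (rule bounded_clinearI)
    show "R (u + w) = R u + R w" for u w
      by (metis RT TR T.add)
    show "R (k *\<^sub>C u) = k *\<^sub>C R u" for k u
      by (metis RT TR bounded_clinear_shifted_op bounded_clinear_def)
    show "norm (R u) \<le> inverse c * norm u" for u
      using c(2)[of "R u"] c(1) by (simp add: TR field_simps)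
  qed
  thus "z \<notin> spectrum T" using TR RT by (auto simp: spectrum_def assms)
qed

end

section \<open>Fredholm half-line operators\<close>

lift_definition ell2_single :: "'a \<Rightarrow> complex \<Rightarrow> 'a ell2" is "\<lambda>a c x. if x = a then c else 0"
  unfolding square_summable_iff_bounded_sums
proof (intro exI allI impI)
  fix a :: 'a and c :: complex and F :: "'a set"
  assume "finite F"
  have "(\<Sum>x\<in>F. (cmod (if x = a then c else 0))\<^sup>2) = (\<Sum>x\<in>F. if x = a then (cmod c)\<^sup>2 else 0)"
    by (rule sum.cong) auto
  thus "(\<Sum>x\<in>F. (cmod (if x = a then c else 0))\<^sup>2) \<le> (cmod c)\<^sup>2"
    using \<open>finite F\<close> by (simp add: sum.delta)
qed

definition ell2_tail :: "nat \<Rightarrow> nat ell2 set" where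
  "ell2_tail N = {u. \<forall>n<N. ell2_apply u n = 0}"

lemma bounded_linear_ell2_apply: "bounded_linear (\<lambda>u. ell2_apply u x)"
  by (rule bounded_linear_intro[where K = 1]) (auto simp: cmod_le_norm_ell2)

lemmas tendsto_ell2_apply = bounded_linear.tendsto[OF bounded_linear_ell2_apply]

lemma subspace_ell2_tail: "subspace (ell2_tail N)"
  by (auto simp: subspace_def ell2_tail_def)

lemma closed_ell2_tail: "closed (ell2_tail N)"
proof -
  have "ell2_tail N = (\<Inter>n\<in>{..<N}. (\<lambda>u. ell2_apply u n) -` {0})"
    by (auto simp: ell2_tail_def)
  also have "closed \<dots>"
    by (intro closed_INT ballI closed_vimage linear_continuous_on bounded_linear_ell2_apply) auto
  finally show ?thesis .
qed

text \<open>The missing term at \<open>n = 0\<close> makes the initial value determine the whole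
  solution, so the solutions form a space of dimension at most one. No summability is assumed, so
  this also applies to formal solutions.\<close>

lemma recurrence_unique_zero:
  fixes f :: "nat \<Rightarrow> complex"
  assumes "\<And>n. f (Suc n) + (if n = 0 then 0 else f (n - 1)) + a n * f n = 0" "f 0 = 0"
  shows "f n = 0"
proof -
  have "f n = 0 \<and> f (Suc n) = 0"
  proof (induction n)
    case 0
    show ?case using assms(1)[of 0] assms(2) by simp
  next
    case (Suc n)
    thus ?case using assms(1)[of "Suc n"] by simp
  qed
  thus ?thesis ..
qed

section \<open>Kernel and range of the half-line operator\<close>

context
  fixes v :: "nat \<Rightarrow> real" and z :: complex and T
  assumes bdd: "bounded (range v)"
  defines "T \<equiv> shifted_op Suc v z"
begin

lemma ell2_apply_shifted_op_Suc:
  "ell2_apply (T u) n = ell2_apply u (Suc n) + (if n = 0 then 0 else ell2_apply u (n - 1))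
     + (of_real (v n) - z) * ell2_apply u n"
proof (cases n)
  case (Suc m)
  thus ?thesis by (simp add: T_def ell2_apply_shifted_op[OF inj_Suc bdd] inv_f_f[OF inj_Suc])
qed (simp add: T_def ell2_apply_shifted_op[OF inj_Suc bdd] image_iff)

interpretation T: bounded_linear T
  unfolding T_def by (rule bounded_linear_shifted_op[OF inj_Suc bdd])

lemma shifted_op_Suc_scaleC: "T (c *\<^sub>C u) = c *\<^sub>C T u"
  using bounded_clinear_shifted_op[OF inj_Suc bdd] by (simp add: bounded_clinear_def T_def)

text \<open>Evaluation at \<open>0\<close> is injective on the kernel, so any nonzero kernel element
  spans it; \<open>p = 0\<close> covers the trivial kernel.\<close>

lemma kernel_shifted_op_Suc: "\<exists>p. \<forall>u. T u = 0 \<longleftrightarrow> (\<exists>k. u = k *\<^sub>C p)"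
proof -
  have zero: "u = 0" if "T u = 0" "ell2_apply u 0 = 0" for u
  proof (rule ell2_eqI)
    fix n
    have "ell2_apply u n = 0"
      by (rule recurrence_unique_zero[where a = "\<lambda>n. of_real (v n) - z"])
        (use that in \<open>simp_all only: ell2_apply_shifted_op_Suc[symmetric] ell2_rep_eq\<close>)
    thus "ell2_apply u n = ell2_apply 0 n" by simp
  qed
  show ?thesis
  proof (cases "\<exists>p. T p = 0 \<and> p \<noteq> 0")
    case True
    then obtain p where p: "T p = 0" "p \<noteq> 0" by blast
    hence p0: "ell2_apply p 0 \<noteq> 0" using zero by blast
    have "u = (ell2_apply u 0 / ell2_apply p 0) *\<^sub>C p" if "T u = 0" for u
    proof -
      have "u - (ell2_apply u 0 / ell2_apply p 0) *\<^sub>C p = 0"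
        by (rule zero) (use that p p0 in \<open>auto simp: T.diff shifted_op_Suc_scaleC\<close>)
      thus ?thesis by simp
    qed
    moreover have "T (k *\<^sub>C p) = 0" for k using p by (simp add: shifted_op_Suc_scaleC)
    ultimately show ?thesis by blast
  next
    case False
    thus ?thesis by (intro exI[of _ 0]) (auto simp: T.zero)
  qed
qed

text \<open>One more coordinate is one complex line, that is, two real lines. The nested form lets
  \<open>closed_subspace_add_line\<close> be applied twice.\<close>

lemma shifted_op_Suc_image_tail:
  "T ` ell2_tail n = {m + r *\<^sub>R T (ell2_single n \<i>) |m r.
     m \<in> {m + r *\<^sub>R T (ell2_single n 1) |m r. m \<in> T ` ell2_tail (Suc n)}}" (is "_ = ?R")
proof (intro equalityI subsetI)
  fix y assume "y \<in> T ` ell2_tail n"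
  then obtain u where u: "u \<in> ell2_tail n" "y = T u" by blast
  define w where "w = u - Re (ell2_apply u n) *\<^sub>R ell2_single n 1 - Im (ell2_apply u n) *\<^sub>R ell2_single n \<i>"
  have "w \<in> ell2_tail (Suc n)"
    using u(1) by (auto simp: ell2_tail_def w_def less_Suc_eq ell2_single.rep_eq complex_eq_iff)
  moreover have "y = (T w + Re (ell2_apply u n) *\<^sub>R T (ell2_single n 1))
      + Im (ell2_apply u n) *\<^sub>R T (ell2_single n \<i>)"
    by (simp add: u(2) w_def T.diff T.scaleR)
  ultimately show "y \<in> ?R" by blast
next
  fix y assume "y \<in> ?R"
  then obtain u q r where u: "u \<in> ell2_tail (Suc n)"
    "y = (T u + q *\<^sub>R T (ell2_single n 1)) + r *\<^sub>R T (ell2_single n \<i>)" by blast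
  have "y = T (u + q *\<^sub>R ell2_single n 1 + r *\<^sub>R ell2_single n \<i>)"
    by (simp add: u(2) T.add T.scaleR)
  moreover have "u + q *\<^sub>R ell2_single n 1 + r *\<^sub>R ell2_single n \<i> \<in> ell2_tail n"
    using u(1) by (auto simp: ell2_tail_def ell2_single.rep_eq)
  ultimately show "y \<in> T ` ell2_tail n" by blast
qed

text \<open>The image of the tail from \<open>N\<close> is closed by the lower bound; going down
  from \<open>N\<close> to \<open>0\<close> adds finitely many real lines, so the whole range is
  closed. Its orthogonal complement consists of conjugates of kernel elements, so one further vector
  completes the range.\<close>

lemma fredholm_if_bounded_below_on_tail:
  assumes "0 < c" "\<And>u. u \<in> ell2_tail N \<Longrightarrow> c * norm u \<le> norm (T u)"
  shows "fredholm T"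
proof -
  have "closed (T ` ell2_tail n)" if "n \<le> N" for n
    using that
  proof (induction rule: inc_induct)
    case base
    have "complete (T ` ell2_tail N)"
      using assms closed_ell2_tail
      by (intro complete_isometric_image[of c] subspace_ell2_tail T.bounded_linear_axioms)
        (auto simp: complete_eq_closed)
    thus ?case by (rule complete_imp_closed)
  next
    case (step n)
    have "subspace (T ` ell2_tail (Suc n))"
      by (intro linear_subspace_image subspace_ell2_tail T.linear)
    with step.IH show ?case
      by (subst shifted_op_Suc_image_tail) (intro closed_subspace_add_line subspace_add_line)
  qed
  from this[of 0] have closed: "closed (range T)" by (simp add: ell2_tail_def)
  obtain p where p: "\<And>u. T u = 0 \<longleftrightarrow> (\<exists>k. u = k *\<^sub>C p)"
    using kernel_shifted_op_Suc by blast
  have "{u. T u = 0} = ell2.span {p}"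
    by (auto simp: p ell2.span_singleton)
  moreover have "x \<in> ell2.span (range T \<union> {ell2_cnj p})" for x
  proof -
    have "subspace (range T)"
      unfolding T_def by (rule subspace_range_shifted_op[OF inj_Suc bdd])
    from orthogonal_projection_exists[OF this closed, of x]
    obtain m where m: "m \<in> range T" "\<And>u. inner (x - m) (T u) = 0" by blast
    have "T (ell2_cnj (x - m)) = 0"
      using m(2) unfolding T_def by (rule orthogonal_range_shifted_op[OF inj_Suc bdd])
    then obtain k where k: "ell2_cnj (x - m) = k *\<^sub>C p" using p by blast
    have "x = m + cnj k *\<^sub>C ell2_cnj p"
    proof (rule ell2_eqI)
      fix n
      have "cnj (ell2_apply (x - m) n) = k * ell2_apply p n"
        using arg_cong[OF k, of "\<lambda>u. ell2_apply u n"] by (simp add: ell2_cnj.rep_eq)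
      hence "ell2_apply (x - m) n = cnj (k * ell2_apply p n)"
        by (metis complex_cnj_cnj)
      thus "ell2_apply x n = ell2_apply (m + cnj k *\<^sub>C ell2_cnj p) n"
        by (simp add: ell2_cnj.rep_eq algebra_simps)
    qed
    also have "\<dots> \<in> ell2.span (range T \<union> {ell2_cnj p})"
      using m(1) by (intro ell2.span_add ell2.span_scale ell2.span_base) auto
    finally show ?thesis .
  qed
  hence "ell2.span (range T \<union> {ell2_cnj p}) = UNIV" by blast
  moreover have "bounded_clinear T"
    unfolding T_def by (rule bounded_clinear_shifted_op[OF inj_Suc bdd])
  ultimately show ?thesis
    unfolding fredholm_def using closed by (metis finite.emptyI finite.insertI)
qed

section \<open>Approximate eigenvectors with disjoint supports and non-closed range\<close>

lemma ell2_apply_sum: "ell2_apply (sum f A) x = (\<Sum>j\<in>A. ell2_apply (f j) x)"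
  by (induction A rule: infinite_finite_induct) auto

text \<open>The supports are disjoint, so \<open>g\<close> has squared mass
  \<open>(cmod (\<gamma> j))\<^sup>2\<close> on the block of \<open>u j\<close>, and these masses
  are summable. Stopping the sum at \<open>n\<close> loses nothing, because \<open>u j\<close>
  vanishes below \<open>j\<close>.\<close>

lemma block_coefficients_tendsto_0:
  fixes u :: "nat \<Rightarrow> nat ell2" and a b :: "nat \<Rightarrow> nat"
  assumes supp: "\<And>j n. n < a j \<or> b j \<le> n \<Longrightarrow> ell2_apply (u j) n = 0"
    and unit: "\<And>j. norm (u j) = 1" and a: "\<And>j. j \<le> a j" and ba: "\<And>i j. i < j \<Longrightarrow> b i \<le> a j"
    and g: "\<And>n. ell2_apply g n = (\<Sum>j\<le>n. \<gamma> j * ell2_apply (u j) n)"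
  shows "\<gamma> \<longlonglongrightarrow> 0"
proof -
  have block: "ell2_apply g n = \<gamma> j * ell2_apply (u j) n" if "n \<in> {a j..<b j}" for n j
  proof -
    have "ell2_apply (u i) n = 0" if "i \<noteq> j" for i
      using \<open>n \<in> {a j..<b j}\<close> ba[of i j] ba[of j i] that by (intro supp) (auto simp: neq_iff)
    moreover have "j \<le> n" using that a[of j] by auto
    ultimately have "(\<Sum>i\<le>n. \<gamma> i * ell2_apply (u i) n) = (\<Sum>i\<in>{j}. \<gamma> i * ell2_apply (u i) n)"
      by (intro sum.mono_neutral_right) auto
    thus ?thesis by (simp add: g)
  qed
  have coeff: "(\<Sum>n\<in>{a j..<b j}. (cmod (ell2_apply g n))\<^sup>2) = (cmod (\<gamma> j))\<^sup>2" for j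
  proof -
    have "(\<Sum>n\<in>{a j..<b j}. (cmod (ell2_apply g n))\<^sup>2)
        = (cmod (\<gamma> j))\<^sup>2 * (\<Sum>n\<in>{a j..<b j}. (cmod (ell2_apply (u j) n))\<^sup>2)"
      unfolding sum_distrib_left
      by (rule sum.cong) (simp_all add: block norm_mult power_mult_distrib)
    also have "(\<Sum>n\<in>{a j..<b j}. (cmod (ell2_apply (u j) n))\<^sup>2) = (norm (u j))\<^sup>2"
      by (rule norm_ell2_finite[symmetric]) (use supp[of _ j] in \<open>auto simp: not_le\<close>)
    finally show ?thesis by (simp add: unit)
  qed
  have "(\<Sum>j<m. (cmod (\<gamma> j))\<^sup>2) \<le> (norm g)\<^sup>2" for m
  proof -
    have "(\<Sum>j<m. (cmod (\<gamma> j))\<^sup>2) = (\<Sum>n\<in>(\<Union>j<m. {a j..<b j}). (cmod (ell2_apply g n))\<^sup>2)"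
    proof (subst sum.UNION_disjoint)
      show "\<forall>i\<in>{..<m}. \<forall>j\<in>{..<m}. i \<noteq> j \<longrightarrow> {a i..<b i} \<inter> {a j..<b j} = {}"
      proof (intro ballI impI)
        fix i j :: nat assume "i \<noteq> j"
        with ba[of i j] ba[of j i] show "{a i..<b i} \<inter> {a j..<b j} = {}"
          by (auto simp: neq_iff)
      qed
    qed (simp_all add: coeff)
    also have "\<dots> \<le> (norm g)\<^sup>2" by (rule sum_le_norm_ell2) auto
    finally show ?thesis .
  qed
  hence "summable (\<lambda>j. (cmod (\<gamma> j))\<^sup>2)"
    by (intro summableI_nonneg_bounded) auto
  hence "(\<lambda>j. (cmod (\<gamma> j))\<^sup>2) \<longlonglongrightarrow> 0" by (rule summable_LIMSEQ_zero)
  hence "(\<lambda>j. cmod (\<gamma> j)) \<longlonglongrightarrow> 0"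
    using tendsto_real_sqrt[of "\<lambda>j. (cmod (\<gamma> j))\<^sup>2" 0] by simp
  thus ?thesis by (rule tendsto_norm_zero_cancel)
qed

text \<open>If the range were closed, it would contain the sum of the images \<open>T u\<^sub>j\<close> of far-out unit vectors
  with \<open>\<parallel>T u\<^sub>j\<parallel> \<le> 2\<^sup>-\<^sup>j\<close>, over even as well as over odd \<open>j\<close>. A preimage differs from the formal sum of
  the \<open>u\<^sub>j\<close> by a formal solution of the recurrence. The solutions being one-dimensional, a
  combination of the two formal sums would be square-summable.\<close>

lemma range_not_closed:
  assumes approx: "\<And>e N. 0 < e \<Longrightarrow>
    \<exists>u M. (\<forall>n. n < N \<or> M \<le> n \<longrightarrow> ell2_apply u n = 0) \<and> norm u = 1 \<and> norm (T u) < e"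
  shows "\<not> closed (range T)"
proof
  assume closed: "closed (range T)"
  let ?P = "\<lambda>j (u, a, b). (\<forall>n. n < a \<or> b \<le> n \<longrightarrow> ell2_apply u n = 0) \<and> norm u = 1 \<and>
    norm (T u) < (1 / 2) ^ j \<and> j \<le> a"
  \<comment> \<open>Besides separating consecutive blocks, the monotonicity of their starting points
    extends the separation to any two blocks.\<close>
  let ?Q = "\<lambda>(u, a, b) (u', a', b'). (b :: nat) \<le> a' \<and> a \<le> a'"
  have "\<exists>f. \<forall>j. ?P j (f j) \<and> ?Q (f j) (f (Suc j))"
  proof (rule dependent_nat_choice)
    show "\<exists>x. ?P 0 x" using approx[of 1 0] by fastforce
  next
    fix x :: "nat ell2 \<times> nat \<times> nat" and j
    obtain u a b where x: "x = (u, a, b)" by (cases x)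
    obtain u' M where "\<forall>n. n < max (Suc j) (max a b) \<or> M \<le> n \<longrightarrow> ell2_apply u' n = 0" "norm u' = 1"
      "norm (T u') < (1 / 2) ^ Suc j"
      using approx[of "(1 / 2) ^ Suc j" "max (Suc j) (max a b)"] by auto
    thus "\<exists>y. ?P (Suc j) y \<and> ?Q x y"
      by (intro exI[of _ "(u', max (Suc j) (max a b), M)"]) (simp add: x le_max_iff_disj)
  qed
  then obtain f where f: "\<forall>j. ?P j (f j) \<and> ?Q (f j) (f (Suc j))" ..
  define u where "u j = fst (f j)" for j
  define a where "a j = fst (snd (f j))" for j
  define b where "b j = snd (snd (f j))" for j
  have supp: "ell2_apply (u j) n = 0" if "n < a j \<or> b j \<le> n" for j n
    using f[rule_format, of j] that by (auto simp: u_def a_def b_def split: prod.splits)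
  have unit: "norm (u j) = 1" and small: "norm (T (u j)) < (1 / 2) ^ j" and ja: "j \<le> a j" for j
    using f[rule_format, of j] by (auto simp: u_def a_def b_def split: prod.splits)
  have step: "b j \<le> a (Suc j)" "a j \<le> a (Suc j)" for j
    using f[rule_format, of j] by (auto simp: a_def b_def split: prod.splits)
  have ba: "b i \<le> a j" if "i < j" for i j
    using step(1)[of i] lift_Suc_mono_le[of a "Suc i" j] step(2) that by auto
  have block: "\<gamma> \<longlonglongrightarrow> 0" if "\<And>n. ell2_apply g n = (\<Sum>j\<le>n. \<gamma> j * ell2_apply (u j) n)" for \<gamma> g
    by (rule block_coefficients_tendsto_0[of a b u, OF _ unit ja _ that]) (use supp ba in blast)+
  have zero: "ell2_apply (u j) n = 0" if "n < j" for j n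
    using ja[of j] that by (intro supp) auto
  \<comment> \<open>The formal sum of the \<open>e j *\<^sub>C u j\<close>: at \<open>n\<close> only
    the terms with \<open>j \<le> n\<close> can contribute.\<close>
  define U where "U e n = (\<Sum>j\<le>n. e j * ell2_apply (u j) n)" for e :: "nat \<Rightarrow> complex" and n
  have ex: "\<exists>w. \<forall>n. (ell2_apply w (Suc n) - U e (Suc n))
        + (if n = 0 then 0 else ell2_apply w (n - 1) - U e (n - 1))
        + (of_real (v n) - z) * (ell2_apply w n - U e n) = 0"
    if e: "\<And>j. cmod (e j) \<le> 1" for e
  proof -
    define S where "S k = (\<Sum>j<k. e j *\<^sub>C u j)" for k
    have S: "ell2_apply (S k) n = U e n" if "n < k" for k n
      unfolding S_def U_def using that zero
      by (simp add: ell2_apply_sum) (intro sum.mono_neutral_right; auto)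
    have "summable (\<lambda>j. e j *\<^sub>C T (u j))"
    proof (rule summable_comparison_test)
      have "norm (e j *\<^sub>C T (u j)) \<le> (1 / 2) ^ j" for j
        unfolding norm_scaleC using e[of j] small[of j]
          mult_mono[of "cmod (e j)" 1 "norm (T (u j))" "(1 / 2) ^ j"] by simp
      thus "\<exists>N. \<forall>j\<ge>N. norm (e j *\<^sub>C T (u j)) \<le> (1 / 2) ^ j" by blast
      show "summable (\<lambda>j. (1 / 2 :: real) ^ j)" by (rule summable_geometric) simp
    qed
    then obtain y where "(\<lambda>j. e j *\<^sub>C T (u j)) sums y" by (auto simp: summable_def)
    hence y: "(\<lambda>k. T (S k)) \<longlonglongrightarrow> y"
      by (simp add: sums_def S_def T.sum shifted_op_Suc_scaleC)
    have "y \<in> range T" by (rule closed_sequentially[OF closed _ y]) auto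
    then obtain w where w: "y = T w" by blast
    have "(\<lambda>k. T (w - S k)) \<longlonglongrightarrow> T w - y"
      unfolding T.diff by (intro tendsto_intros y)
    hence lim: "(\<lambda>k. ell2_apply (T (w - S k)) n) \<longlonglongrightarrow> 0" for n
      using tendsto_ell2_apply[of "\<lambda>k. T (w - S k)" "T w - y" sequentially n] by (simp add: w)
    show ?thesis
    proof (intro exI allI)
      fix n
      let ?x = "(ell2_apply w (Suc n) - U e (Suc n))
        + (if n = 0 then 0 else ell2_apply w (n - 1) - U e (n - 1))
        + (of_real (v n) - z) * (ell2_apply w n - U e n)"
      \<comment> \<open>\<open>U e\<close> need not be square-summable, so \<open>T\<close> is
        applied to partial sums only. A coordinate of the image involves just the neighbouring
        sites, where \<open>S k\<close> agrees with \<open>U e\<close> as soon as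
        \<open>k > Suc n\<close>.\<close>
      have "ell2_apply (T (w - S k)) n = ?x" if "k > Suc n" for k
        using that by (simp add: ell2_apply_shifted_op_Suc S)
      hence "\<forall>\<^sub>F k in sequentially. ell2_apply (T (w - S k)) n = ?x"
        by (rule eventually_mono[OF eventually_gt_at_top[of "Suc n"]])
      hence "(\<lambda>k. ell2_apply (T (w - S k)) n) \<longlonglongrightarrow> ?x" by (rule tendsto_eventually)
      thus "?x = 0" using lim by (rule LIMSEQ_unique)
    qed
  qed
  define e\<^sub>0 :: "nat \<Rightarrow> complex" where "e\<^sub>0 j = of_bool (even j)" for j
  define e\<^sub>1 :: "nat \<Rightarrow> complex" where "e\<^sub>1 j = of_bool (odd j)" for j
  have "cmod (e\<^sub>0 j) \<le> 1" "cmod (e\<^sub>1 j) \<le> 1" for j by (simp_all add: e\<^sub>0_def e\<^sub>1_def)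
  then obtain w\<^sub>0 w\<^sub>1 where w: "\<And>n. (ell2_apply w\<^sub>0 (Suc n) - U e\<^sub>0 (Suc n))
        + (if n = 0 then 0 else ell2_apply w\<^sub>0 (n - 1) - U e\<^sub>0 (n - 1))
        + (of_real (v n) - z) * (ell2_apply w\<^sub>0 n - U e\<^sub>0 n) = 0"
      "\<And>n. (ell2_apply w\<^sub>1 (Suc n) - U e\<^sub>1 (Suc n))
        + (if n = 0 then 0 else ell2_apply w\<^sub>1 (n - 1) - U e\<^sub>1 (n - 1))
        + (of_real (v n) - z) * (ell2_apply w\<^sub>1 n - U e\<^sub>1 n) = 0"
    using ex[of e\<^sub>0] ex[of e\<^sub>1] by blast
  define X where "X n = ell2_apply w\<^sub>0 n - U e\<^sub>0 n" for n
  define Y where "Y n = ell2_apply w\<^sub>1 n - U e\<^sub>1 n" for n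
  have X: "X (Suc n) + (if n = 0 then 0 else X (n - 1)) + (of_real (v n) - z) * X n = 0"
    and Y: "Y (Suc n) + (if n = 0 then 0 else Y (n - 1)) + (of_real (v n) - z) * Y n = 0" for n
    using w[of n] by (simp_all only: X_def Y_def)
  \<comment> \<open>The coefficients make this combination of two formal solutions vanish at
    \<open>0\<close>, hence everywhere.\<close>
  have comb: "Y 0 * X n - X 0 * Y n = 0" for n
  proof (rule recurrence_unique_zero[where a = "\<lambda>n. of_real (v n) - z"])
    fix n
    have "(Y 0 * X (Suc n) - X 0 * Y (Suc n))
        + (if n = 0 then 0 else Y 0 * X (n - 1) - X 0 * Y (n - 1))
        + (of_real (v n) - z) * (Y 0 * X n - X 0 * Y n)
        = Y 0 * (X (Suc n) + (if n = 0 then 0 else X (n - 1)) + (of_real (v n) - z) * X n)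
        - X 0 * (Y (Suc n) + (if n = 0 then 0 else Y (n - 1)) + (of_real (v n) - z) * Y n)"
      by (simp add: algebra_simps)
    thus "(Y 0 * X (Suc n) - X 0 * Y (Suc n))
        + (if n = 0 then 0 else Y 0 * X (n - 1) - X 0 * Y (n - 1))
        + (of_real (v n) - z) * (Y 0 * X n - X 0 * Y n) = 0"
      by (simp only: X Y mult_zero_right diff_self)
  qed simp
  have "(\<lambda>j. Y 0 * e\<^sub>0 j - X 0 * e\<^sub>1 j) \<longlonglongrightarrow> 0"
  proof (rule block)
    fix n
    have "ell2_apply (Y 0 *\<^sub>C w\<^sub>0 - X 0 *\<^sub>C w\<^sub>1) n = Y 0 * U e\<^sub>0 n - X 0 * U e\<^sub>1 n"
      using comb[of n] unfolding X_def[of n] Y_def[of n] by (simp add: algebra_simps)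
    thus "ell2_apply (Y 0 *\<^sub>C w\<^sub>0 - X 0 *\<^sub>C w\<^sub>1) n
        = (\<Sum>j\<le>n. (Y 0 * e\<^sub>0 j - X 0 * e\<^sub>1 j) * ell2_apply (u j) n)"
      by (simp add: U_def sum_distrib_left sum_subtractf algebra_simps)
  qed
  \<comment> \<open>At odd indices the coefficient is \<open>- X 0\<close>, so
    \<open>X 0 = 0\<close> and then \<open>X\<close> vanishes. Hence the formal sum over even
    indices is itself square-summable, although its coefficients there are \<open>1\<close>.\<close>
  from LIMSEQ_subseq_LIMSEQ[OF this, of "\<lambda>i. 2 * i + 1"]
  have "(\<lambda>i::nat. - X 0) \<longlonglongrightarrow> 0"
    by (simp add: o_def e\<^sub>0_def e\<^sub>1_def strict_mono_def)
  hence "X 0 = 0" by (simp add: LIMSEQ_const_iff)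
  have "X n = 0" for n
    by (rule recurrence_unique_zero[OF X \<open>X 0 = 0\<close>])
  hence "ell2_apply w\<^sub>0 n = (\<Sum>j\<le>n. e\<^sub>0 j * ell2_apply (u j) n)" for n
    unfolding X_def U_def by simp
  hence "e\<^sub>0 \<longlonglongrightarrow> 0" by (rule block)
  from LIMSEQ_subseq_LIMSEQ[OF this, of "\<lambda>i. 2 * i"]
  have "(\<lambda>i::nat. 1 :: complex) \<longlonglongrightarrow> 0"
    by (simp add: o_def e\<^sub>0_def strict_mono_def)
  thus False by (simp add: LIMSEQ_const_iff)
qed

end

section \<open>Irrational rotations\<close>

lemma cmod_cis_diff_le: "cmod (cis a - cis b) \<le> \<bar>a - b\<bar>"
proof -
  have "cis a - cis b = cis b * (exp (\<i> * of_real (a - b)) - 1)"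
    by (simp add: cis_conv_exp algebra_simps flip: exp_add)
  hence "cmod (cis a - cis b) = 2 * \<bar>sin ((a - b) / 2)\<bar>"
    by (simp only: norm_mult norm_cis dist_exp_i_1)
  thus ?thesis using abs_sin_x_le_abs_x[of "(a - b) / 2"] by simp
qed

text \<open>A bound by distance on the circle, rather than by the difference of angles, ignores
  multiples of \<open>2 * pi\<close>, as needed to compare rotation phases.\<close>

lemma abs_cos_diff_le: "\<bar>cos (a + b) - cos (a + c)\<bar> \<le> cmod (cis b - cis c)"
proof -
  have "cos (a + b) - cos (a + c) = Re (cis a * (cis b - cis c))"
    by (simp add: right_diff_distrib cis_mult)
  also have "\<bar>\<dots>\<bar> \<le> cmod (cis a * (cis b - cis c))" by (rule abs_Re_le_cmod)
  finally show ?thesis by (simp only: norm_mult norm_cis)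
qed

text \<open>Density of the fractional parts of positive multiples gives a time \<open>r\<close> for
  each \<open>w\<close>; compactness of the circle bounds these times independently of
  \<open>w\<close>. The window length can therefore be fixed before the distance out is
  chosen.\<close>

lemma rotation_orbit_uniformly_dense:
  fixes beta :: real
  assumes "beta / (2 * pi) \<notin> \<rat>" "0 < d"
  obtains M :: nat where "\<And>w. cmod w = 1 \<Longrightarrow> \<exists>r\<le>M. cmod (cis (beta * real r) - w) < d"
proof -
  have dense: "\<exists>r::nat. cmod (cis (beta * real r) - w) < d" if "cmod w = 1" for w
  proof -
    define t where "t = Arg w"
    have t: "w = cis t"
      using that cis_Arg[of w] by (cases "w = 0") (auto simp: t_def sgn_eq)
    have "0 < d / (2 * pi)" using assms(2) by simp
    from sequence_of_fractional_parts_is_dense[OF assms(1) this, of "t / (2 * pi)"]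
    obtain h k :: int where k: "0 < k"
      "\<bar>of_int k * (beta / (2 * pi)) - of_int h - t / (2 * pi)\<bar> < d / (2 * pi)" by blast
    have "beta * of_int k - 2 * pi * of_int h - t
        = 2 * pi * (of_int k * (beta / (2 * pi)) - of_int h - t / (2 * pi))"
      by (simp add: field_simps)
    hence "\<bar>beta * of_int k - 2 * pi * of_int h - t\<bar>
        = 2 * pi * \<bar>of_int k * (beta / (2 * pi)) - of_int h - t / (2 * pi)\<bar>"
      by (simp only: abs_mult) simp
    also have "\<dots> < d" using k(2) by (simp add: field_simps)
    finally have "cmod (cis (beta * of_int k - 2 * pi * of_int h) - cis t) < d"
      using cmod_cis_diff_le[of "beta * of_int k - 2 * pi * of_int h" t] by linarith
    moreover have "cis (beta * of_int k - 2 * pi * of_int h) = cis (beta * of_int k)"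
      by (simp add: cis_divide[symmetric] cis_multiple_2pi)
    ultimately show ?thesis using k(1) t by (intro exI[of _ "nat k"]) simp
  qed
  let ?f = "\<lambda>r::nat. ball (cis (beta * real r)) d"
  have cover: "sphere 0 1 \<subseteq> (\<Union>r\<in>UNIV. ?f r)"
    using dense by (auto simp: dist_norm)
  obtain C where "C \<subseteq> UNIV" and C: "finite C" "sphere 0 1 \<subseteq> (\<Union>r\<in>C. ?f r)"
    by (rule compactE_image[where f = ?f, OF compact_sphere _ cover]) simp
  show ?thesis
  proof (rule that)
    fix w :: complex assume "cmod w = 1"
    hence "w \<in> sphere 0 1" by simp
    then obtain r where "r \<in> C" "w \<in> ball (cis (beta * real r)) d" using C(2) by blast
    with C(1) show "\<exists>r\<le>Max C. cmod (cis (beta * real r) - w) < d"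
      by (intro exI[of _ r]) (auto simp: dist_norm)
  qed
qed

text \<open>Beyond \<open>(L / d)\<^sup>2\<close> one has \<open>L \<le> d * sqrt j\<close>, and
  then the square of \<open>sqrt j + d\<close> exceeds \<open>j + L\<close>.\<close>

lemma sqrt_increments_small:
  assumes "0 < d"
  obtains N :: nat where "\<And>j n :: nat. N \<le> j \<Longrightarrow> j \<le> n \<Longrightarrow> n \<le> j + L \<Longrightarrow> \<bar>sqrt (real n) - sqrt (real j)\<bar> \<le> d"
proof -
  obtain N :: nat where N: "(real L / d)\<^sup>2 < real N" using reals_Archimedean2 by blast
  show ?thesis
  proof (rule that)
    fix j n :: nat assume j: "N \<le> j" "j \<le> n" "n \<le> j + L"
    have "real L / d < sqrt (real j)"
      using N j(1) by (intro real_less_rsqrt) linarith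
    hence Ld: "real L \<le> d * sqrt (real j)" using assms by (simp add: field_simps)
    have "(sqrt (real j) + d)\<^sup>2 = real j + 2 * (d * sqrt (real j)) + d\<^sup>2"
      by (simp add: power2_sum)
    moreover have "real n \<le> real j + real L" using j(3) by linarith
    moreover have "0 \<le> d * sqrt (real j)" "0 \<le> d\<^sup>2" using assms by simp_all
    ultimately have "real n \<le> (sqrt (real j) + d)\<^sup>2" using Ld by linarith
    hence "sqrt (real n) \<le> sqrt (real j) + d"
      using assms by (intro real_le_lsqrt) auto
    thus "\<bar>sqrt (real n) - sqrt (real j)\<bar> \<le> d" using j(2) by simp
  qed
qed

section \<open>Comparison of the half-line and the whole-line operator\<close>

text \<open>Site \<open>n\<close> of the half-line is placed at \<open>n + k\<close>. Moving the
  vector keeps the whole-line operator fixed while \<open>k\<close> selects the stretch of its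
  potential to compare with.\<close>

definition ell2_embed :: "int \<Rightarrow> nat ell2 \<Rightarrow> int ell2" where
  "ell2_embed k = ell2_pull {k..} (\<lambda>m. nat (m - k))"

lemma inj_on_embed: "inj_on (\<lambda>m. nat (m - k)) {k..}"
  by (auto simp: inj_on_def)

lemma ell2_apply_embed:
  "ell2_apply (ell2_embed k u) m = (if k \<le> m then ell2_apply u (nat (m - k)) else 0)"
  by (simp add: ell2_embed_def ell2_apply_pull[OF inj_on_embed])

lemma norm_embed: "norm (ell2_embed k u) = norm u"
  unfolding ell2_embed_def
proof (rule norm_pull_eq[OF inj_on_embed])
  fix n :: nat assume "n \<notin> (\<lambda>m. nat (m - k)) ` {k..}"
  moreover have "n = nat (int n + k - k)" "int n + k \<in> {k..}" by auto
  ultimately show "ell2_apply u n = 0" by blast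
qed

lemma ell2_apply_shifted_op_int:
  assumes "bounded (range V)"
  shows "ell2_apply (shifted_op (\<lambda>n::int. n + 1) V z u) m =
    ell2_apply u (m + 1) + ell2_apply u (m - 1) + (of_real (V m) - z) * ell2_apply u m"
proof -
  have inj: "inj (\<lambda>n::int. n + 1)" by (auto simp: inj_def)
  have m: "m = (m - 1) + 1" by simp
  have "m \<in> range (\<lambda>n::int. n + 1)" using m by (rule range_eqI)
  moreover have "inv (\<lambda>n::int. n + 1) m = m - 1" using inj by (rule inv_f_eq) simp
  ultimately show ?thesis by (simp add: ell2_apply_shifted_op[OF inj assms])
qed

text \<open>The hopping terms agree except at site \<open>k - 1\<close>, where the whole-line
  operator produces the value of \<open>u\<close> at \<open>0\<close>; this explains the boundary
  condition on \<open>u\<close>. What remains is multiplication by the difference of the potentials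
  on the support of \<open>u\<close>.\<close>

lemma shifted_op_embed:
  assumes V: "bounded (range V)" and v: "bounded (range v)" and u0: "ell2_apply u 0 = 0"
    and d: "\<And>n. ell2_apply u n \<noteq> 0 \<Longrightarrow> \<bar>V (int n + k) - v n\<bar> \<le> d" and "0 \<le> d"
  shows "norm (shifted_op (\<lambda>n. n + 1) V z (ell2_embed k u) - ell2_embed k (shifted_op Suc v z u))
    \<le> d * norm u"
proof -
  have "cmod (ell2_apply (shifted_op (\<lambda>n. n + 1) V z (ell2_embed k u)
          - ell2_embed k (shifted_op Suc v z u)) m)
      \<le> d * cmod (ell2_apply (ell2_embed k u) m)" (is "cmod ?x \<le> _") for m
  proof (cases "k \<le> m")
    case True
    define n where "n = nat (m - k)"
    have m: "m = int n + k" using True by (simp add: n_def)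
    have "nat (m + 1 - k) = Suc n" "nat (m - 1 - k) = n - 1" "nat (m - k) = n"
      "k \<le> m + 1" "k \<le> m - 1 \<longleftrightarrow> n \<noteq> 0"
      by (auto simp: m)
    hence "?x = of_real (V m - v n) * ell2_apply u n"
      using True
      by (simp add: ell2_apply_shifted_op_int[OF V] ell2_apply_embed ell2_apply_shifted_op_Suc[OF v] algebra_simps
          del: One_nat_def)
    hence "cmod ?x = \<bar>V m - v n\<bar> * cmod (ell2_apply u n)"
      by (simp only: norm_mult norm_of_real real_norm_def)
    also have "\<dots> \<le> d * cmod (ell2_apply u n)"
      using d[of n] by (cases "ell2_apply u n = 0") (auto simp: m intro: mult_right_mono)
    finally show ?thesis using True by (simp add: ell2_apply_embed n_def)
  next
    case False
    thus ?thesis using u0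
      by (cases "m = k - 1") (auto simp: ell2_apply_shifted_op_int[OF V] ell2_apply_embed)
  qed
  from norm_ell2_mono[OF this \<open>0 \<le> d\<close>] show ?thesis by (simp add: norm_embed)
qed

lemma restrict_lessThan_tendsto: "(\<lambda>M. ell2_restrict {..<M} u) \<longlonglongrightarrow> (u :: nat ell2)"
proof (rule LIMSEQ_I)
  fix e :: real assume "0 < e"
  from finite_restriction_approx[OF this, of u] obtain F where
    F: "finite F" "\<And>G. finite G \<Longrightarrow> F \<subseteq> G \<Longrightarrow> norm (u - ell2_restrict G u) < e" by blast
  obtain K where K: "F \<subseteq> {..<K}" using F(1) finite_nat_iff_bounded by blast
  have "norm (ell2_restrict {..<M} u - u) < e" if "M \<ge> K" for M
  proof -
    have "F \<subseteq> {..<M}" using K that by auto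
    thus ?thesis using F(2) by (simp add: norm_minus_commute)
  qed
  thus "\<exists>K. \<forall>M\<ge>K. norm (ell2_restrict {..<M} u - u) < e" by blast
qed

lemma restrict_symmetric_tendsto: "(\<lambda>M. ell2_restrict {- int M..int M} u) \<longlonglongrightarrow> u"
proof (rule LIMSEQ_I)
  fix e :: real assume "0 < e"
  from finite_restriction_approx[OF this, of u] obtain F where
    F: "finite F" "\<And>G. finite G \<Longrightarrow> F \<subseteq> G \<Longrightarrow> norm (u - ell2_restrict G u) < e" by blast
  obtain K where K: "\<And>m. m \<in> F \<Longrightarrow> nat \<bar>m\<bar> < K"
    using F(1) finite_nat_iff_bounded[of "(\<lambda>m. nat \<bar>m\<bar>) ` F"] by auto
  have "norm (ell2_restrict {- int M..int M} u - u) < e" if "M \<ge> K" for M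
  proof -
    have "F \<subseteq> {- int M..int M}" using K that by (force simp: subset_eq)
    thus ?thesis using F(2) by (simp add: norm_minus_commute)
  qed
  thus "\<exists>K. \<forall>M\<ge>K. norm (ell2_restrict {- int M..int M} u - u) < e" by blast
qed

lemma sum_reindex_le_norm:
  fixes f :: "nat ell2"
  assumes "inj_on h A" "finite A"
  shows "(\<Sum>j\<in>A. (cmod (ell2_apply f (h j)))\<^sup>2) \<le> (norm f)\<^sup>2"
proof -
  have "(\<Sum>j\<in>A. (cmod (ell2_apply f (h j)))\<^sup>2) = (\<Sum>n\<in>h ` A. (cmod (ell2_apply f n))\<^sup>2)"
    using assms(1) by (simp add: sum.reindex)
  also have "\<dots> \<le> (norm f)\<^sup>2" using assms(2) by (intro sum_le_norm_ell2) auto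
  finally show ?thesis .
qed

lemma norm_restrict_interval:
  fixes u :: "nat ell2"
  shows "(norm (ell2_restrict {j..<j + L} u))\<^sup>2 = (\<Sum>i<L. (cmod (ell2_apply u (j + i)))\<^sup>2)"
proof -
  have "(norm (ell2_restrict {j..<j + L} u))\<^sup>2
      = (\<Sum>n\<in>{j..<j + L}. (cmod (ell2_apply (ell2_restrict {j..<j + L} u) n))\<^sup>2)"
    by (rule norm_ell2_finite) auto
  also have "\<dots> = (\<Sum>n\<in>(\<lambda>i. j + i) ` {..<L}. (cmod (ell2_apply u n))\<^sup>2)"
    by (rule sum.cong) (auto simp: lessThan_atLeast0)
  also have "\<dots> = (\<Sum>i<L. (cmod (ell2_apply u (j + i)))\<^sup>2)"
    by (subst sum.reindex) auto
  finally show ?thesis .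
qed

lemma norm_add_power2_le: "(norm (x + y))\<^sup>2 \<le> 2 * (norm x)\<^sup>2 + 2 * (norm (y :: 'a :: real_inner))\<^sup>2"
proof -
  have "(norm (x + y))\<^sup>2 + (norm (x - y))\<^sup>2 = 2 * (norm x)\<^sup>2 + 2 * (norm y)\<^sup>2"
    unfolding power2_norm_eq_inner by (simp add: inner_add inner_diff inner_commute)
  moreover have "0 \<le> (norm (x - y))\<^sup>2" by simp
  ultimately show ?thesis by linarith
qed

section \<open>Lower bounds from windows of fixed length\<close>

context
  fixes v :: "nat \<Rightarrow> real" and z :: complex and T
  assumes bdd: "bounded (range v)"
  defines "T \<equiv> shifted_op Suc v z"
begin

text \<open>The commutator \<open>w\<close> of \<open>T\<close> with the cut-off lives on the two
  sites at either end of the window. The conditions on \<open>j\<close> and \<open>L\<close> keep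
  these four sites distinct.\<close>

lemma norm_shifted_op_restrict_le:
  assumes "1 \<le> j" "2 \<le> L"
  shows "(norm (T (ell2_restrict {j..<j + L} u)))\<^sup>2
    \<le> 2 * (\<Sum>i<L. (cmod (ell2_apply (T u) (j + i)))\<^sup>2)
      + 2 * ((cmod (ell2_apply u j))\<^sup>2 + (cmod (ell2_apply u (j - 1)))\<^sup>2
        + (cmod (ell2_apply u (j + L)))\<^sup>2 + (cmod (ell2_apply u (j + L - 1)))\<^sup>2)"
proof -
  let ?R = "ell2_restrict {j..<j + L}"
  define w where "w = T (?R u) - ?R (T u)"
  have T: "ell2_apply (T x) n = ell2_apply x (Suc n) + (case n of 0 \<Rightarrow> 0 | Suc m \<Rightarrow> ell2_apply x m)
      + (of_real (v n) - z) * ell2_apply x n" for x n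
    by (simp add: T_def ell2_apply_shifted_op_Suc[OF bdd] split: nat.split)
  have w: "ell2_apply w n = (if n = j - 1 then ell2_apply u j
      else if n = j then - ell2_apply u (j - 1)
      else if n = j + L - 1 then - ell2_apply u (j + L)
      else if n = j + L then ell2_apply u (j + L - 1) else 0)" for n
  proof -
    \<comment> \<open>This removes subtraction on naturals: the window becomes
      \<open>{a + 1..a + l + 2}\<close>, and \<open>w\<close> can be nonzero only at
      \<open>a\<close>, \<open>a + 1\<close>, \<open>a + l + 2\<close> and
      \<open>a + l + 3\<close>.\<close>
    obtain a l where j: "j = Suc a" "L = l + 2"
      using assms by (metis add.commute le_Suc_ex plus_1_eq_Suc)
    consider "n < a" | "n = a" | "n = Suc a" | "Suc a < n" "n < a + l + 2" | "n = a + l + 2"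
      | "n = a + l + 3" | "a + l + 3 < n" by linarith
    thus ?thesis by cases (auto simp: w_def T j split: nat.split)
  qed
  have ne: "j - 1 \<noteq> j" "j - 1 \<noteq> j + L - 1" "j - 1 \<noteq> j + L" "j \<noteq> j + L - 1" "j \<noteq> j + L"
    "j + L - 1 \<noteq> j + L"
    using assms by auto
  note ne = ne ne[symmetric]
  have "(norm w)\<^sup>2 = (\<Sum>n\<in>{j - 1, j, j + L - 1, j + L}. (cmod (ell2_apply w n))\<^sup>2)"
    by (rule norm_ell2_finite) (auto simp: w)
  also have "\<dots> = (cmod (ell2_apply w (j - 1)))\<^sup>2 + ((cmod (ell2_apply w j))\<^sup>2
      + ((cmod (ell2_apply w (j + L - 1)))\<^sup>2 + (cmod (ell2_apply w (j + L)))\<^sup>2))"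
    using ne by simp
  also have "ell2_apply w (j - 1) = ell2_apply u j" by (simp only: w if_True refl)
  also have "ell2_apply w j = - ell2_apply u (j - 1)" by (simp only: w ne if_False if_True refl)
  also have "ell2_apply w (j + L - 1) = - ell2_apply u (j + L)"
    by (simp only: w ne if_False if_True refl)
  also have "ell2_apply w (j + L) = ell2_apply u (j + L - 1)"
    by (simp only: w ne if_False if_True refl)
  finally have nw: "(norm w)\<^sup>2 = (cmod (ell2_apply u j))\<^sup>2 + (cmod (ell2_apply u (j - 1)))\<^sup>2
        + (cmod (ell2_apply u (j + L)))\<^sup>2 + (cmod (ell2_apply u (j + L - 1)))\<^sup>2"
    by simp
  have "T (?R u) = ?R (T u) + w" by (simp add: w_def)
  hence "(norm (T (?R u)))\<^sup>2 \<le> 2 * (norm (?R (T u)))\<^sup>2 + 2 * (norm w)\<^sup>2"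
    by (simp add: norm_add_power2_le)
  thus ?thesis by (simp only: nw norm_restrict_interval)
qed

text \<open>Averaging over all translates of a window of length \<open>L\<close>, the commutator with the cut-off
  contributes boundary terms of relative size \<open>1 / L\<close> only.\<close>

lemma bounded_below_if_locally_bounded_below_finite:
  assumes c: "0 < c" and L: "2 \<le> L" "16 \<le> c\<^sup>2 * real L" and N: "1 \<le> N"
    and local: "\<And>j w. N \<le> j \<Longrightarrow> (\<And>n. n \<notin> {j..<j + L} \<Longrightarrow> ell2_apply w n = 0) \<Longrightarrow>
      c * norm w \<le> norm (T w)"
    and supp: "\<And>n. n \<notin> {N + L..<M} \<Longrightarrow> ell2_apply u n = 0"
  shows "c / 2 * norm u \<le> norm (T u)"
proof -
  have window: "c\<^sup>2 * (\<Sum>i<L. (cmod (ell2_apply u (j + i)))\<^sup>2)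
      \<le> 2 * (\<Sum>i<L. (cmod (ell2_apply (T u) (j + i)))\<^sup>2)
        + 2 * ((cmod (ell2_apply u j))\<^sup>2 + (cmod (ell2_apply u (j - 1)))\<^sup>2
        + (cmod (ell2_apply u (j + L)))\<^sup>2 + (cmod (ell2_apply u (j + L - 1)))\<^sup>2)"
    if "j \<in> {N..<M}" for j
  proof -
    let ?w = "ell2_restrict {j..<j + L} u"
    have "c * norm ?w \<le> norm (T ?w)" using that by (intro local[of j]) auto
    hence "(c * norm ?w)\<^sup>2 \<le> (norm (T ?w))\<^sup>2" using c by (intro power_mono) auto
    also have "\<dots> \<le> 2 * (\<Sum>i<L. (cmod (ell2_apply (T u) (j + i)))\<^sup>2)
        + 2 * ((cmod (ell2_apply u j))\<^sup>2 + (cmod (ell2_apply u (j - 1)))\<^sup>2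
        + (cmod (ell2_apply u (j + L)))\<^sup>2 + (cmod (ell2_apply u (j + L - 1)))\<^sup>2)"
      using that N L by (intro norm_shifted_op_restrict_le) auto
    finally show ?thesis by (simp only: power_mult_distrib norm_restrict_interval)
  qed
  \<comment> \<open>For every offset \<open>i < L\<close> the range \<open>{N + i..<M + i}\<close>
    contains \<open>{N + L..<M}\<close>; this is why the support starts only at
    \<open>N + L\<close>.\<close>
  have total: "(\<Sum>j\<in>{N..<M}. (cmod (ell2_apply u (j + i)))\<^sup>2) = (norm u)\<^sup>2" if "i < L" for i
  proof -
    have "(\<Sum>j\<in>{N..<M}. (cmod (ell2_apply u (j + i)))\<^sup>2)
        = (\<Sum>n\<in>{N + i..<M + i}. (cmod (ell2_apply u n))\<^sup>2)"
      by (rule sum.shift_bounds_nat_ivl[symmetric])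
    also have "\<dots> = (norm u)\<^sup>2"
      by (rule norm_ell2_finite[symmetric]) (use supp that in auto)
    finally show ?thesis .
  qed
  have "c\<^sup>2 * (real L * (norm u)\<^sup>2) = (\<Sum>j\<in>{N..<M}. c\<^sup>2 * (\<Sum>i<L. (cmod (ell2_apply u (j + i)))\<^sup>2))"
    unfolding sum_distrib_left[symmetric] by (subst sum.swap) (simp add: total)
  also have "\<dots> \<le> (\<Sum>j\<in>{N..<M}. 2 * (\<Sum>i<L. (cmod (ell2_apply (T u) (j + i)))\<^sup>2)
        + 2 * ((cmod (ell2_apply u j))\<^sup>2 + (cmod (ell2_apply u (j - 1)))\<^sup>2
        + (cmod (ell2_apply u (j + L)))\<^sup>2 + (cmod (ell2_apply u (j + L - 1)))\<^sup>2))"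
    by (rule sum_mono) (rule window)
  also have "\<dots> = 2 * (\<Sum>i<L. \<Sum>j\<in>{N..<M}. (cmod (ell2_apply (T u) (j + i)))\<^sup>2)
        + 2 * ((\<Sum>j\<in>{N..<M}. (cmod (ell2_apply u j))\<^sup>2) + (\<Sum>j\<in>{N..<M}. (cmod (ell2_apply u (j - 1)))\<^sup>2)
        + (\<Sum>j\<in>{N..<M}. (cmod (ell2_apply u (j + L)))\<^sup>2) + (\<Sum>j\<in>{N..<M}. (cmod (ell2_apply u (j + L - 1)))\<^sup>2))"
    by (subst sum.swap) (simp only: sum.distrib sum_distrib_left[symmetric])
  also have "\<dots> \<le> 2 * (\<Sum>i<L. (norm (T u))\<^sup>2)
        + 2 * ((norm u)\<^sup>2 + (norm u)\<^sup>2 + (norm u)\<^sup>2 + (norm u)\<^sup>2)"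
    using N L by (intro add_mono mult_left_mono sum_mono sum_reindex_le_norm) (auto simp: inj_on_def)
  finally have main: "c\<^sup>2 * real L * (norm u)\<^sup>2 \<le> 2 * real L * (norm (T u))\<^sup>2 + 8 * (norm u)\<^sup>2"
    by (simp add: algebra_simps)
  \<comment> \<open>The boundary terms add up to \<open>8 * (norm u)\<^sup>2\<close>, so the
    constant 16 makes them at most half of the left-hand side.\<close>
  have "16 * (norm u)\<^sup>2 \<le> c\<^sup>2 * real L * (norm u)\<^sup>2"
    using L(2) by (intro mult_right_mono) auto
  with main have "c\<^sup>2 * real L * (norm u)\<^sup>2 \<le> 4 * real L * (norm (T u))\<^sup>2" by linarith
  hence "real L * (c * norm u)\<^sup>2 \<le> real L * (2 * norm (T u))\<^sup>2"
    by (simp add: power_mult_distrib algebra_simps)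
  hence "(c * norm u)\<^sup>2 \<le> (2 * norm (T u))\<^sup>2" using L(1) by simp
  hence "c * norm u \<le> 2 * norm (T u)" by (rule power2_le_imp_le) simp
  thus ?thesis by simp
qed

text \<open>Truncations of a tail vector stay in the tail and are finitely supported; both sides are
  continuous in \<open>u\<close>.\<close>

lemma bounded_below_if_locally_bounded_below:
  assumes c: "0 < c" and L: "2 \<le> L" "16 \<le> c\<^sup>2 * real L" and N: "1 \<le> N"
    and local: "\<And>j w. N \<le> j \<Longrightarrow> (\<And>n. n \<notin> {j..<j + L} \<Longrightarrow> ell2_apply w n = 0) \<Longrightarrow>
      c * norm w \<le> norm (T w)"
    and u: "u \<in> ell2_tail (N + L)"
  shows "c / 2 * norm u \<le> norm (T u)"
proof (rule LIMSEQ_le)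
  have "bounded_linear T"
    unfolding T_def by (rule bounded_linear_shifted_op[OF inj_Suc bdd])
  from bounded_linear.tendsto[OF this restrict_lessThan_tendsto]
  show "(\<lambda>M. norm (T (ell2_restrict {..<M} u))) \<longlonglongrightarrow> norm (T u)" by (rule tendsto_norm)
  show "(\<lambda>M. c / 2 * norm (ell2_restrict {..<M} u)) \<longlonglongrightarrow> c / 2 * norm u"
    by (rule tendsto_mult[OF tendsto_const tendsto_norm[OF restrict_lessThan_tendsto]])
  have "c / 2 * norm (ell2_restrict {..<M} u) \<le> norm (T (ell2_restrict {..<M} u))" for M
    by (rule bounded_below_if_locally_bounded_below_finite[OF c L N local, where M = M])
      (use u in \<open>auto simp: ell2_tail_def\<close>)
  thus "\<exists>K. \<forall>M\<ge>K. c / 2 * norm (ell2_restrict {..<M} u) \<le> norm (T (ell2_restrict {..<M} u))" by blast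
qed

end

section \<open>The two cosine potentials\<close>

context
  fixes lam alpha :: real and v :: "nat \<Rightarrow> real" and V :: "int \<Rightarrow> real"
  assumes irrational: "alpha / (2 * pi) \<notin> \<rat>"
  defines "v \<equiv> \<lambda>n. lam * cos (alpha * real n + sqrt (real n))"
    and "V \<equiv> \<lambda>n. lam * cos (alpha * real_of_int n)"
begin

lemma bounded_potentials: "bounded (range v)" "bounded (range V)"
  by (auto simp: bounded_iff v_def V_def abs_mult intro!: exI[of _ "\<bar>lam\<bar>"] mult_left_le)

text \<open>The arguments of the cosines share \<open>alpha * n\<close>, so only the mismatch on the
  circle between the phases \<open>alpha * k\<close> and \<open>sqrt n\<close> counts.\<close>

lemma potential_difference_le:
  "\<bar>V (int n + k) - v n\<bar> \<le> \<bar>lam\<bar> * cmod (cis (alpha * real_of_int k) - cis (sqrt (real n)))"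
proof -
  have "V (int n + k) - v n
      = lam * (cos (alpha * real n + alpha * real_of_int k) - cos (alpha * real n + sqrt (real n)))"
    by (simp add: v_def V_def algebra_simps)
  thus ?thesis
    using abs_cos_diff_le[of "alpha * real n" "alpha * real_of_int k" "sqrt (real n)"]
    by (simp add: abs_mult mult_left_mono)
qed

text \<open>On a far-out window starting at \<open>j\<close> the phase \<open>sqrt n\<close> is
  nearly \<open>sqrt j\<close>, and some translation by \<open>r\<close> nearly produces that phase.
  The comparison costs half of \<open>c\<close>, the averaging another factor of two.\<close>

lemma bounded_below_on_tail:
  assumes c: "0 < c" "\<And>w. c * norm w \<le> norm (shifted_op (\<lambda>n. n + 1) V z w)"
  shows "\<exists>N c'. 0 < c' \<and> (\<forall>u\<in>ell2_tail N. c' * norm u \<le> norm (shifted_op Suc v z u))"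
proof -
  \<comment> \<open>The averaging is applied with the constant \<open>c / 2\<close> that is
    available on windows.\<close>
  obtain L0 :: nat where L0: "16 / (c / 2)\<^sup>2 \<le> real L0" using real_arch_simple by blast
  define L where "L = max 2 L0"
  have "16 \<le> (c / 2)\<^sup>2 * real L0" using L0 c(1) by (simp add: field_simps)
  also have "\<dots> \<le> (c / 2)\<^sup>2 * real L" by (intro mult_left_mono) (auto simp: L_def)
  finally have L: "2 \<le> L" "16 \<le> (c / 2)\<^sup>2 * real L" by (auto simp: L_def)
  \<comment> \<open>Two phase errors of size \<open>d\<close>, from the rotation and from the square
    root, must cost at most \<open>c / 2\<close>; the added 1 covers \<open>lam = 0\<close>.\<close>
  define d where "d = c / (4 * (\<bar>lam\<bar> + 1))"
  have d: "0 < d" using c(1) by (simp add: d_def add_nonneg_pos)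
  have lam_d: "\<bar>lam\<bar> * (2 * d) \<le> c / 2"
    using c(1) by (simp add: d_def field_simps)
  obtain N where N: "\<And>j n. N \<le> j \<Longrightarrow> j \<le> n \<Longrightarrow> n \<le> j + L \<Longrightarrow> \<bar>sqrt (real n) - sqrt (real j)\<bar> \<le> d"
    using sqrt_increments_small[OF d, of L] by blast
  obtain M where M: "\<And>w. cmod w = 1 \<Longrightarrow> \<exists>r\<le>M. cmod (cis (alpha * real r) - w) < d"
    using rotation_orbit_uniformly_dense[OF irrational d] by blast
  have "c / 2 * norm w \<le> norm (shifted_op Suc v z w)"
    if j: "max 1 N \<le> j" and w: "\<And>n. n \<notin> {j..<j + L} \<Longrightarrow> ell2_apply w n = 0" for j w
  proof -
    obtain r where r: "cmod (cis (alpha * real r) - cis (sqrt (real j))) < d"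
      using M[of "cis (sqrt (real j))"] by auto
    have "\<bar>V (int n + int r) - v n\<bar> \<le> c / 2" if "ell2_apply w n \<noteq> 0" for n
    proof -
      have n: "n \<in> {j..<j + L}" using w that by blast
      have "cmod (cis (alpha * real r) - cis (sqrt (real n)))
          \<le> cmod (cis (alpha * real r) - cis (sqrt (real j))) + cmod (cis (sqrt (real j)) - cis (sqrt (real n)))"
        using norm_triangle_ineq[of "cis (alpha * real r) - cis (sqrt (real j))"
            "cis (sqrt (real j)) - cis (sqrt (real n))"] by simp
      also have "cmod (cis (sqrt (real j)) - cis (sqrt (real n))) \<le> \<bar>sqrt (real j) - sqrt (real n)\<bar>"
        by (rule cmod_cis_diff_le)
      also have "\<dots> \<le> d" using N[of j n] n j by (simp add: abs_minus_commute)
      finally have "cmod (cis (alpha * real r) - cis (sqrt (real n))) \<le> 2 * d" using r by simp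
      hence "\<bar>lam\<bar> * cmod (cis (alpha * real r) - cis (sqrt (real n))) \<le> \<bar>lam\<bar> * (2 * d)"
        by (intro mult_left_mono) auto
      thus ?thesis using potential_difference_le[of n "int r"] lam_d by simp
    qed
    moreover have "ell2_apply w 0 = 0" using j by (intro w) auto
    ultimately have "norm (shifted_op (\<lambda>n. n + 1) V z (ell2_embed (int r) w)
        - ell2_embed (int r) (shifted_op Suc v z w)) \<le> c / 2 * norm w"
      using c(1) by (intro shifted_op_embed bounded_potentials) auto
    moreover have "c * norm w \<le> norm (shifted_op (\<lambda>n. n + 1) V z (ell2_embed (int r) w))"
      using c(2)[of "ell2_embed (int r) w"] by (simp add: norm_embed)
    moreover have "norm (shifted_op (\<lambda>n. n + 1) V z (ell2_embed (int r) w))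
        \<le> norm (ell2_embed (int r) (shifted_op Suc v z w))
          + norm (shifted_op (\<lambda>n. n + 1) V z (ell2_embed (int r) w)
            - ell2_embed (int r) (shifted_op Suc v z w))"
      by (rule norm_triangle_sub)
    ultimately show ?thesis by (simp add: norm_embed)
  qed
  note local = this
  have "c / 2 / 2 * norm u \<le> norm (shifted_op Suc v z u)" if "u \<in> ell2_tail (max 1 N + L)" for u
    by (rule bounded_below_if_locally_bounded_below[OF bounded_potentials(1) _ L _ local that])
      (use c(1) in auto)
  thus ?thesis using c(1) by (intro exI[of _ "max 1 N + L"] exI[of _ "c / 2 / 2"]) auto
qed

lemma approximate_eigenvectors_far_out:
  assumes not_below: "\<not> (\<exists>c>0. \<forall>w. c * norm w \<le> norm (shifted_op (\<lambda>n. n + 1) V z w))"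
    and e: "0 < e"
  shows "\<exists>u M. (\<forall>n. n < N \<or> M \<le> n \<longrightarrow> ell2_apply u n = 0) \<and> norm u = 1 \<and>
    norm (shifted_op Suc v z u) < e"
proof -
  let ?S = "shifted_op (\<lambda>n. n + 1) V z" and ?T = "shifted_op Suc v z"
  have inj: "inj (\<lambda>n::int. n + 1)" by (auto simp: inj_def)
  interpret S: bounded_linear ?S
    by (rule bounded_linear_shifted_op[OF inj bounded_potentials(2)])
  have "0 < e / 2" using e by simp
  with not_below obtain w where "\<not> e / 2 * norm w \<le> norm (?S w)" by blast
  hence w: "norm (?S w) - e / 2 * norm w < 0" by simp
  \<comment> \<open>The violated bound is a strict inequality, so by continuity it persists for a
    finite truncation.\<close>
  have "(\<lambda>M. norm (?S (ell2_restrict {- int M..int M} w)) - e / 2 * norm (ell2_restrict {- int M..int M} w))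
      \<longlonglongrightarrow> norm (?S w) - e / 2 * norm w"
    by (intro tendsto_intros S.tendsto restrict_symmetric_tendsto)
  from order_tendstoD(2)[OF this w] obtain M where
    M: "norm (?S (ell2_restrict {- int M..int M} w)) - e / 2 * norm (ell2_restrict {- int M..int M} w) < 0"
    by (auto simp: eventually_sequentially)
  define r where "r = ell2_restrict {- int M..int M} w"
  have "r \<noteq> 0" using M by (auto simp: r_def[symmetric] S.zero)
  define y where "y = inverse (norm r) *\<^sub>R r"
  have y1: "norm y = 1" using \<open>r \<noteq> 0\<close> by (simp add: y_def)
  have "norm r * norm (?S y) = norm (?S r)" using \<open>r \<noteq> 0\<close> by (simp add: y_def S.scaleR)
  also have "\<dots> < norm r * (e / 2)" using M by (simp add: r_def[symmetric] mult.commute)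
  finally have Sy: "norm (?S y) < e / 2"
    by (rule mult_left_less_imp_less) simp
  have ysupp: "ell2_apply y m = 0" if "m \<notin> {- int M..int M}" for m
    using that by (auto simp: y_def r_def)
  define d where "d = e / (4 * (\<bar>lam\<bar> + 1))"
  have d: "0 < d" using e by (simp add: d_def add_nonneg_pos)
  have lam_d: "\<bar>lam\<bar> * (2 * d) \<le> e / 2"
    using e by (simp add: d_def field_simps)
  \<comment> \<open>Site \<open>0\<close> of the whole line will be moved to site \<open>K\<close>
    of the half-line, so the embedding back has offset \<open>- K\<close> and phase
    \<open>- alpha * K\<close>.\<close>
  have "- alpha / (2 * pi) \<notin> \<rat>" using irrational by simp
  from rotation_orbit_uniformly_dense[OF this d]
  obtain R where R: "\<And>w. cmod w = 1 \<Longrightarrow> \<exists>r\<le>R. cmod (cis (- alpha * real r) - w) < d" by blast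
  \<comment> \<open>The moved vector is supported between \<open>K - M\<close> and
    \<open>K + M\<close>. With \<open>K = j + M + q\<close> and \<open>q \<le> R\<close> this lies
    between \<open>j\<close> and \<open>j + (R + 2 * M)\<close>.\<close>
  obtain J where J: "\<And>j n. J \<le> j \<Longrightarrow> j \<le> n \<Longrightarrow> n \<le> j + (R + 2 * M) \<Longrightarrow>
      \<bar>sqrt (real n) - sqrt (real j)\<bar> \<le> d"
    using sqrt_increments_small[OF d, of "R + 2 * M"] by blast
  \<comment> \<open>The summand 1 keeps the support away from site \<open>0\<close>, as the
    comparison of the operators requires.\<close>
  define j where "j = max J (N + 1)"
  \<comment> \<open>The translation must be at least \<open>j + M\<close>. The phase of this part is
    moved into the target, and only the bounded remainder \<open>q\<close> is sought.\<close>
  have "cmod (cis (sqrt (real j) + alpha * real (j + M))) = 1" by simp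
  from R[OF this] obtain q where q: "q \<le> R"
    "cmod (cis (- alpha * real q) - cis (sqrt (real j) + alpha * real (j + M))) < d" by blast
  define K where "K = j + M + q"
  have "cis (- alpha * real K) - cis (sqrt (real j))
      = cis (- alpha * real (j + M)) *
        (cis (- alpha * real q) - cis (sqrt (real j) + alpha * real (j + M)))"
    by (simp add: right_diff_distrib cis_mult K_def) (simp add: algebra_simps)
  hence K: "cmod (cis (- alpha * real K) - cis (sqrt (real j))) < d"
    using q(2) by (simp only: norm_mult norm_cis mult_1)
  define u where "u = ell2_pull UNIV (\<lambda>n. int n - int K) y"
  have u: "ell2_apply u n = ell2_apply y (int n - int K)" for n
    by (simp add: u_def ell2_apply_pull inj_def)
  have usupp: "K - M \<le> n \<and> n \<le> K + M" if "ell2_apply u n \<noteq> 0" for n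
    using ysupp[of "int n - int K"] that u[of n] by fastforce
  \<comment> \<open>Nothing is cut off, because \<open>K\<close> is at least
    \<open>M\<close>.\<close>
  have embed: "ell2_embed (- int K) u = y"
  proof (rule ell2_eqI)
    fix m
    show "ell2_apply (ell2_embed (- int K) u) m = ell2_apply y m"
      using ysupp[of m] by (auto simp: ell2_apply_embed u K_def)
  qed
  hence u1: "norm u = 1" using y1 norm_embed[of "- int K" u] by simp
  have "\<bar>V (int n + - int K) - v n\<bar> \<le> e / 2" if "ell2_apply u n \<noteq> 0" for n
  proof -
    have n: "j \<le> n" "n \<le> j + (R + 2 * M)" using usupp[OF that] q(1) by (auto simp: K_def)
    have "cmod (cis (- alpha * real K) - cis (sqrt (real n)))
        \<le> cmod (cis (- alpha * real K) - cis (sqrt (real j))) + cmod (cis (sqrt (real j)) - cis (sqrt (real n)))"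
      using norm_triangle_ineq[of "cis (- alpha * real K) - cis (sqrt (real j))"
          "cis (sqrt (real j)) - cis (sqrt (real n))"] by simp
    also have "cmod (cis (sqrt (real j)) - cis (sqrt (real n))) \<le> \<bar>sqrt (real j) - sqrt (real n)\<bar>"
      by (rule cmod_cis_diff_le)
    also have "\<dots> \<le> d" using J[of j n] n by (simp add: abs_minus_commute j_def)
    finally have "cmod (cis (- alpha * real K) - cis (sqrt (real n))) \<le> 2 * d" using K by simp
    hence "\<bar>lam\<bar> * cmod (cis (- alpha * real K) - cis (sqrt (real n))) \<le> \<bar>lam\<bar> * (2 * d)"
      by (intro mult_left_mono) auto
    thus ?thesis using potential_difference_le[of n "- int K"] lam_d by simp
  qed
  moreover have "ell2_apply u 0 = 0" using usupp[of 0] by (auto simp: K_def j_def)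
  ultimately have "norm (?S (ell2_embed (- int K) u) - ell2_embed (- int K) (?T u)) \<le> e / 2 * norm u"
    using e by (intro shifted_op_embed bounded_potentials) auto
  moreover have "norm (ell2_embed (- int K) (?T u)) \<le> norm (?S (ell2_embed (- int K) u))
      + norm (?S (ell2_embed (- int K) u) - ell2_embed (- int K) (?T u))"
    by (metis norm_minus_commute norm_triangle_sub)
  ultimately have "norm (?T u) < e" using Sy by (simp add: embed u1 norm_embed)
  moreover have "\<forall>n. n < N \<or> K + M + 1 \<le> n \<longrightarrow> ell2_apply u n = 0"
    using usupp by (fastforce simp: K_def j_def)
  ultimately show ?thesis using u1 by blast
qed

text \<open>For each \<open>z\<close>, absence from either side amounts to a lower bound for the
  whole-line operator. Without such a bound the half-line operator already violates the closed-range
  condition.\<close>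

lemma essential_spectrum_eq_spectrum:
  "essential_spectrum (schrodinger_nat v) = spectrum (schrodinger_int V)"
proof -
  have inj: "inj (\<lambda>n::int. n + 1)" by (auto simp: inj_def)
  have nat: "schrodinger_nat v u - z *\<^sub>C u = shifted_op Suc v z u" for u z
    by (rule ell2_eqI) (simp add: ell2_apply_schrodinger_nat[OF bounded_potentials(1)]
        ell2_apply_shifted_op_Suc[OF bounded_potentials(1)] left_diff_distrib)
  have int: "schrodinger_int V u - z *\<^sub>C u = shifted_op (\<lambda>n. n + 1) V z u" for u z
    by (rule ell2_eqI) (simp add: ell2_apply_schrodinger_int[OF bounded_potentials(2)]
        ell2_apply_shifted_op_int[OF bounded_potentials(2)] left_diff_distrib)
  have "fredholm (shifted_op Suc v z) \<longleftrightarrow> z \<notin> spectrum (schrodinger_int V)" for z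
    unfolding spectrum_shifted_op[OF inj bounded_potentials(2) int]
  proof
    assume "fredholm (shifted_op Suc v z)"
    hence "closed (range (shifted_op Suc v z))" by (simp add: fredholm_def)
    thus "\<exists>c>0. \<forall>u. c * norm u \<le> norm (shifted_op (\<lambda>n. n + 1) V z u)"
      using range_not_closed[OF bounded_potentials(1)] approximate_eigenvectors_far_out by blast
  next
    assume "\<exists>c>0. \<forall>u. c * norm u \<le> norm (shifted_op (\<lambda>n. n + 1) V z u)"
    then obtain N c where "0 < c" "\<forall>u\<in>ell2_tail N. c * norm u \<le> norm (shifted_op Suc v z u)"
      using bounded_below_on_tail by blast
    thus "fredholm (shifted_op Suc v z)"
      by (intro fredholm_if_bounded_below_on_tail[OF bounded_potentials(1)]) auto
  qed
  thus ?thesis by (auto simp: essential_spectrum_def nat)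
qed

end

theorem theorem1p3:
  fixes lam alpha :: real
  assumes "alpha / (2 * pi) \<notin> \<rat>"
  shows "essential_spectrum
           (schrodinger_nat (\<lambda>n. lam * cos (alpha * real n + sqrt (real n)))) =
         spectrum (schrodinger_int (\<lambda>n. lam * cos (alpha * real_of_int n)))"
  using assms by (rule essential_spectrum_eq_spectrum)

end
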